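(* Let $r>0$ be a fixed integer. There exists $\ell_0$ such that for every positive integer $c$ divisible by $3$ and every integer $\ell\ge\max(c,\ell_0)$ divisible by $c/3$, $$f_c(\ell,r)<\frac{(30\,\ell\log\ell)^{r+1}}{c^r}.$$ Thus there is a constant $C>0$ such that for every integer $c\ge 3$ and every integer $\ell\ge\max(c,\ell_0)$, $$f_c(\ell,r)<\frac{(C\,\ell\log\ell)^{r+1}}{c^r}.$$
   Context: Graphs are finite, simple and undirected. For a graph $G=(V,E)$, $v\in V$ and a positive integer $r$, the $r$-ball $U_r(v,G)$ is the subgraph of $G$ induced on all vertices at graph distance at most $r$ from $v$. The $r$-local chromatic number of $G$ is $\ell\chi_r(G)=\max_{v\in V}\chi(U_r(v,G))$, where $\chi$ is the chromatic number. For integers $\ell\ge c\ge 2$ and $r>0$, $f_c(\ell,r)$ is the greatest integer $n$ such that every graph on $n$ vertices whose $r$-local chromatic number is at most $c$ is $\ell$-colorable. $\log$ is the natural logarithm. The constants $\ell_0$ and $C$ may depend on the fixed $r$ but not on $c$ or $\ell$. *)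

theory Defs
  imports Complex_Main "Graph_Theory.Graph_Theory"
begin

text \<open>
  A finite simple undirected graph is represented by a \<open>pair_graph\<close>: a finite loop-free
  digraph whose arcs are ordered pairs and form a symmetric relation. The notions below are stated
  for arbitrary digraphs, to which a pair graph is converted by \<open>with_proj\<close>.
\<close>

definition colorable :: "nat \<Rightarrow> ('a, 'b) pre_digraph \<Rightarrow> bool" where
  "colorable k G \<longleftrightarrow>
     (\<exists>f :: 'a \<Rightarrow> nat. f ` verts G \<subseteq> {..<k} \<and> (\<forall>u v. u \<rightarrow>\<^bsub>G\<^esub> v \<longrightarrow> f u \<noteq> f v))"

definition chromatic_number :: "('a, 'b) pre_digraph \<Rightarrow> nat" where
  "chromatic_number G = (LEAST k. colorable k G)"

text \<open>
  Graph distance is \<open>wf_digraph.\<mu>\<close> with all arc weights equal to 1; it is \<open>\<infinity>\<close> between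
  different components.
\<close>

definition graph_ball :: "nat \<Rightarrow> 'a \<Rightarrow> ('a, 'b) pre_digraph \<Rightarrow> ('a, 'b) pre_digraph" where
  "graph_ball r v G =
     G \<restriction> {u \<in> verts G. wf_digraph.\<mu> G (\<lambda>_. 1) v u \<le> ereal (real r)}"

text \<open>The maximum over the vertices; it is 0 for the graph without vertices.\<close>

definition local_chromatic_number :: "nat \<Rightarrow> ('a, 'b) pre_digraph \<Rightarrow> nat" where
  "local_chromatic_number r G = (SUP v \<in> verts G. chromatic_number (graph_ball r v G))"

text \<open>
  Every finite graph is isomorphic to one whose vertices are natural numbers. If the set of \<open>n\<close>
  below were unbounded, the value of \<open>GREATEST\<close> would be unspecified.
\<close>

definition f_loc :: "nat \<Rightarrow> nat \<Rightarrow> nat \<Rightarrow> nat" where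
  "f_loc c l r = (GREATEST n. \<forall>G :: nat pair_pre_digraph.
     pair_graph G \<longrightarrow> card (pverts G) = n \<longrightarrow>
     local_chromatic_number r (with_proj G) \<le> c \<longrightarrow> colorable l (with_proj G))"

end

theory Submission
  imports Defs "HOL-Real_Asymp.Real_Asymp" "HOL-Analysis.Complex_Transcendental"
begin

text \<open>
  It suffices to find, for every \<open>n\<close> from some point on that meets the bound, a graph on \<open>n\<close>
  vertices whose \<open>r\<close>-balls are \<open>c\<close>-colourable and which is not \<open>l\<close>-colourable. Such graphs come
  from the random graph \<open>G(n, p)\<close> by deleting at most a quarter of the vertices and replacing each
  remaining one by a clique.

  Let \<open>L = m ln m\<close>, \<open>n = 30 L (10 L)\<^sup>r\<close>, rounded down, and \<open>p = 3 L / n\<close>. By union bounds, with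
  high probability no set of \<open>3n/(4m)\<close> vertices is independent (\<open>weight_independent_set\<close>) and all
  degrees are at most \<open>7L/2\<close> (\<open>weight_high_degree\<close>). An \<open>r\<close>-ball then has at most \<open>M = (18L/5)\<^sup>r\<close>
  vertices.

  The heart of the matter is that, with probability at least \<open>81/100\<close>, a given ball is
  3-colourable or has more than \<open>M\<close> vertices. A ball that is not 3-colourable contains a set \<open>T\<close>
  of vertices that spans a subgraph of minimum degree at least 3. Fix the breadth-first search
  tree of the ball, and let \<open>A\<close> consist of the vertices of \<open>T\<close> without a child in \<open>T\<close>. Every
  vertex of \<open>T\<close> is in \<open>A\<close> or an ancestor of a vertex in \<open>A\<close>, so \<open>T\<close> lies in a set of at most
  \<open>(r + 1)|A|\<close> vertices. A vertex of \<open>A\<close> has at most one tree edge into \<open>T\<close>, hence at least two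
  other edges into \<open>T\<close>, and there are at least \<open>|A|\<close> non-tree edges between \<open>A\<close> and that set
  (\<open>excess_witness_exists\<close>). Deleting non-tree edges does not change the search tree
  (\<open>bfs_tree_Diff\<close>), so, given the tree, \<open>a\<close> prescribed non-tree edges are present with
  probability at most \<open>(p / (1 - p))\<^sup>a\<close> (\<open>weight_fixed_bfs_tree\<close>). The union bound over \<open>A\<close> and
  over the \<open>a = |A|\<close> edges is the sum over \<open>a \<ge> 1\<close> of
  \<open>(M choose a) ((r + 1) a\<^sup>2 choose a) (p / (1 - p))\<^sup>a\<close>, which is small because \<open>M p\<close> is
  (\<open>weight_bad_ball\<close>, \<open>excess_sum_bound\<close>). By Markov's inequality some graph has all these
  properties and at most \<open>n/4\<close> vertices whose ball is not 3-colourable (\<open>exists_sparse_graph\<close>).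
  Let \<open>W\<close> be the set of the other vertices; it has more than \<open>m\<close> times as many elements as any
  independent set.

  For \<open>c = 3k\<close> and \<open>l = km\<close>, replace each vertex of the graph induced on \<open>W\<close> by a clique on \<open>k\<close>
  vertices. The balls become \<open>3k\<close>-colourable, whereas the independent sets do not grow, so that
  \<open>km\<close> colours do not suffice. The number of vertices is at most
  \<open>k (30 L)\<^bsup>r+1\<^esup> / 3\<^sup>r \<le> (30 l ln l)\<^bsup>r+1\<^esup> / c\<^sup>r\<close>. When \<open>m\<close> is too small for the probabilistic
  estimates, a fixed larger value is used in its place, and the factor \<open>ln l\<close> pays for it. The
  case of arbitrary \<open>c\<close> follows by rounding \<open>c\<close> down to a multiple of 3 and \<open>l\<close> up.

  A graph on the vertex set \<open>V\<close> is represented by its set of edges, a subset of \<open>all_pairs V\<close>.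
  Probabilities are replaced by weights: with \<open>x = p / (1 - p)\<close> an edge set \<open>G\<close> has weight
  \<open>x ^ card G\<close>, and the total weight is \<open>(1 + x) ^ card (all_pairs V)\<close>.
\<close>

section \<open>Edge sets and three-colourability\<close>

text \<open>The edges of the complete graph on \<open>S\<close>.\<close>

definition all_pairs :: "'a set \<Rightarrow> 'a set set" where
  "all_pairs S = {e. e \<subseteq> S \<and> card e = 2}"

text \<open>The subgraph of \<open>G\<close> induced on \<open>S\<close> has a proper colouring with three colours.\<close>

definition three_colorable_on :: "'a set set \<Rightarrow> 'a set \<Rightarrow> bool" where
  "three_colorable_on G S \<longleftrightarrow>
     (\<exists>f :: 'a \<Rightarrow> nat. f ` S \<subseteq> {..<3} \<and> (\<forall>u\<in>S. \<forall>w\<in>S. {u, w} \<in> G \<longrightarrow> f u \<noteq> f w))"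

lemma doubleton_in_all_pairs [simp]:
  "{u, w} \<in> all_pairs S \<longleftrightarrow> u \<in> S \<and> w \<in> S \<and> u \<noteq> w"
  by (auto simp: all_pairs_def card_insert_if)

lemma edge_ends:
  assumes "G \<subseteq> all_pairs V" "{u, w} \<in> G"
  shows "u \<in> V" "w \<in> V" "u \<noteq> w"
  using subsetD[OF assms] by simp_all

lemma finite_all_pairs [simp]: "finite S \<Longrightarrow> finite (all_pairs S)"
  unfolding all_pairs_def by (rule finite_subset[of _ "Pow S"]) auto

lemma card_all_pairs: "finite S \<Longrightarrow> card (all_pairs S) = card S choose 2"
  unfolding all_pairs_def by (rule n_subsets)

lemma all_pairs_mono: "S \<subseteq> T \<Longrightarrow> all_pairs S \<subseteq> all_pairs T"
  unfolding all_pairs_def by auto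

text \<open>
  A minimal set that is not 3-colourable induces a subgraph of minimum degree at least 3: a
  colouring of the rest extends to a vertex with at most two neighbours.
\<close>

lemma minimal_not_three_colorable:
  assumes "finite B" "\<not> three_colorable_on G B" "G \<subseteq> all_pairs V"
  obtains T where "T \<subseteq> B" "T \<noteq> {}"
    "\<And>u. u \<in> T \<Longrightarrow> 3 \<le> card {w \<in> T. {u, w} \<in> G}"
proof -
  define bad where "bad = (\<lambda>T. T \<subseteq> B \<and> \<not> three_colorable_on G T)"
  have "bad B" using assms(2) by (simp add: bad_def)
  then obtain T where T: "bad T" and min: "\<And>S. bad S \<Longrightarrow> card T \<le> card S"
    using ex_has_least_nat[of bad B card] by metis
  have TB: "T \<subseteq> B" and nc: "\<not> three_colorable_on G T" using T by (auto simp: bad_def)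
  have fin: "finite T" using TB assms(1) finite_subset by blast
  have noloop: "{u, u} \<notin> G" for u
    using edge_ends(3)[OF assms(3), of u u] by blast
  have "3 \<le> card {w \<in> T. {u, w} \<in> G}" if u: "u \<in> T" for u
  proof (rule ccontr)
    assume few: "\<not> 3 \<le> card {w \<in> T. {u, w} \<in> G}"
    have "card (T - {u}) < card T" using u fin by (meson card_Diff1_less)
    then have "three_colorable_on G (T - {u})"
      using min[of "T - {u}"] TB by (auto simp: bad_def)
    then obtain f :: "'a \<Rightarrow> nat" where f: "f ` (T - {u}) \<subseteq> {..<3}"
      "\<And>a b. a \<in> T - {u} \<Longrightarrow> b \<in> T - {u} \<Longrightarrow> {a, b} \<in> G \<Longrightarrow> f a \<noteq> f b"
      unfolding three_colorable_on_def by blast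
    have "card (f ` {w \<in> T. {u, w} \<in> G}) < card {..<3::nat}"
      using few card_image_le[of "{w \<in> T. {u, w} \<in> G}" f] fin by simp
    then have "\<not> {..<3} \<subseteq> f ` {w \<in> T. {u, w} \<in> G}"
      using fin card_mono[of "f ` {w \<in> T. {u, w} \<in> G}" "{..<3}"] by fastforce
    then obtain c where c: "c < 3" "c \<notin> f ` {w \<in> T. {u, w} \<in> G}" by auto
    define g where "g = f(u := c)"
    have "g ` T \<subseteq> {..<3}" using f(1) c(1) by (auto simp: g_def)
    moreover have "g a \<noteq> g b" if "a \<in> T" "b \<in> T" "{a, b} \<in> G" for a b
    proof (cases "a = u \<or> b = u")
      case True
      then show ?thesis using that c(2) noloop[of u]
        by (auto simp: g_def insert_commute)
    next
      case False
      then show ?thesis using that f(2)[of a b] by (auto simp: g_def)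
    qed
    ultimately have "three_colorable_on G T" unfolding three_colorable_on_def by blast
    with nc show False ..
  qed
  moreover have "T \<noteq> {}" using nc by (auto simp: three_colorable_on_def)
  ultimately show ?thesis using that TB by blast
qed

section \<open>Balls and breadth-first search trees\<close>

text \<open>The set of vertices that are reached from \<open>v\<close> by a walk of at most the given length.\<close>

fun hop_ball :: "'a set set \<Rightarrow> 'a \<Rightarrow> nat \<Rightarrow> 'a set" where
  "hop_ball G v 0 = {v}"
| "hop_ball G v (Suc i) = hop_ball G v i \<union> {u. \<exists>w\<in>hop_ball G v i. {u, w} \<in> G}"

text \<open>The distance from \<open>v\<close>; meaningful only for vertices that are reachable from \<open>v\<close>.\<close>

definition depth :: "'a set set \<Rightarrow> 'a \<Rightarrow> 'a \<Rightarrow> nat" where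
  "depth G v u = (LEAST i. u \<in> hop_ball G v i)"

text \<open>
  The least neighbour of \<open>u\<close> that is closer to \<open>v\<close>. A canonical choice is needed: it makes the
  tree below a function of the graph, so that the graphs can be classified by their trees.
  Meaningful only for vertices other than \<open>v\<close> that are reachable from \<open>v\<close>.
\<close>

definition parent :: "('a::wellorder) set set \<Rightarrow> 'a \<Rightarrow> 'a \<Rightarrow> 'a" where
  "parent G v u = (LEAST w. {u, w} \<in> G \<and> w \<in> hop_ball G v (depth G v u - 1))"

text \<open>
  The breadth-first search tree of the \<open>r\<close>-ball around \<open>v\<close>, as the relation between each vertex
  other than the root and its parent.
\<close>

definition bfs_tree :: "nat \<Rightarrow> ('a::wellorder) set set \<Rightarrow> 'a \<Rightarrow> ('a \<times> 'a) set" where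
  "bfs_tree r G v = {(u, parent G v u) | u. u \<in> hop_ball G v r - {v}}"

text \<open>The undirected edges underlying a relation.\<close>

definition tree_edges :: "('a \<times> 'a) set \<Rightarrow> 'a set set" where
  "tree_edges F = {{u, w} | u w. (u, w) \<in> F}"

lemma hop_ball_mono: "i \<le> j \<Longrightarrow> hop_ball G v i \<subseteq> hop_ball G v j"
  by (rule lift_Suc_mono_le[of "hop_ball G v"]) auto

lemma hop_ball_subset: "G \<subseteq> H \<Longrightarrow> hop_ball G v i \<subseteq> hop_ball H v i"
  by (induction i) auto

lemma center_in_hop_ball [simp]: "v \<in> hop_ball G v i"
  by (induction i) auto

lemma hop_ball_within: "G \<subseteq> all_pairs V \<Longrightarrow> v \<in> V \<Longrightarrow> hop_ball G v i \<subseteq> V"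
proof (induction i)
  case (Suc i)
  have "u \<in> V" if "{u, w} \<in> G" for u w using edge_ends(1)[OF Suc.prems(1) that] .
  then show ?case using Suc by auto
qed simp

lemma in_hop_ball_depth: "u \<in> hop_ball G v i \<Longrightarrow> u \<in> hop_ball G v (depth G v u)"
  unfolding depth_def by (rule LeastI)

lemma depth_le: "u \<in> hop_ball G v i \<Longrightarrow> depth G v u \<le> i"
  unfolding depth_def by (rule Least_le)

lemma depth_pos: "u \<in> hop_ball G v i \<Longrightarrow> u \<noteq> v \<Longrightarrow> 0 < depth G v u"
  by (metis hop_ball.simps(1) in_hop_ball_depth not_gr_zero singletonD)

lemma parent_props:
  assumes "u \<in> hop_ball G v i" "u \<noteq> v"
  shows "{u, parent G v u} \<in> G" "parent G v u \<in> hop_ball G v (depth G v u - 1)"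
proof -
  obtain j where j: "depth G v u = Suc j" using depth_pos[OF assms] gr0_implies_Suc by blast
  have "u \<in> hop_ball G v (Suc j)" using in_hop_ball_depth[OF assms(1)] j by simp
  moreover have "u \<notin> hop_ball G v j" using depth_le[of u G v j] j by auto
  ultimately have "\<exists>w. {u, w} \<in> G \<and> w \<in> hop_ball G v (depth G v u - 1)" using j by auto
  from LeastI_ex[OF this]
  have "{u, parent G v u} \<in> G \<and> parent G v u \<in> hop_ball G v (depth G v u - 1)"
    unfolding parent_def .
  then show "{u, parent G v u} \<in> G" "parent G v u \<in> hop_ball G v (depth G v u - 1)" by auto
qed

lemma depth_child:
  assumes "(w, u) \<in> bfs_tree r G v"
  shows "depth G v u < depth G v w" "depth G v w \<le> r"
proof -
  have w: "w \<in> hop_ball G v r" "w \<noteq> v" and u: "u = parent G v w"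
    using assms by (auto simp: bfs_tree_def)
  have "depth G v u \<le> depth G v w - 1" using parent_props(2)[OF w] u depth_le by metis
  then show "depth G v u < depth G v w" using depth_pos[OF w] by simp
  show "depth G v w \<le> r" using depth_le[OF w(1)] .
qed

lemma insert_Domain_bfs_tree: "insert v (Domain (bfs_tree r G v)) = hop_ball G v r"
  by (auto simp: bfs_tree_def)

lemma single_valued_bfs_tree: "single_valued (bfs_tree r G v)"
  by (auto simp: bfs_tree_def single_valued_def)

text \<open>
  Deleting edges outside the breadth-first search tree does not change that tree: distances can
  only grow, the tree paths keep them from growing, and the least candidate for a parent survives.
\<close>

lemma bfs_tree_Diff:
  assumes "Q \<inter> tree_edges (bfs_tree r G v) = {}"
  shows "bfs_tree r (G - Q) v = bfs_tree r G v"
proof -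
  define H where "H = G - Q"
  have keep: "{u, parent G v u} \<in> H" if "u \<in> hop_ball G v r" "u \<noteq> v" for u
  proof -
    have "{u, parent G v u} \<in> tree_edges (bfs_tree r G v)"
      using that by (auto simp: tree_edges_def bfs_tree_def)
    then show ?thesis using assms parent_props(1)[OF that] by (auto simp: H_def)
  qed
  have balls: "i \<le> r \<Longrightarrow> hop_ball H v i = hop_ball G v i" for i
  proof (induction i)
    case (Suc i)
    have "hop_ball G v (Suc i) \<subseteq> hop_ball H v (Suc i)"
    proof
      fix u assume u: "u \<in> hop_ball G v (Suc i)"
      show "u \<in> hop_ball H v (Suc i)"
      proof (cases "u \<in> hop_ball G v i \<or> u = v")
        case True
        then show ?thesis using Suc by auto
      next
        case False
        have "u \<in> hop_ball G v r" using hop_ball_mono[OF Suc.prems] u by (rule subsetD)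
        then have "{u, parent G v u} \<in> H" using keep False by blast
        moreover have "depth G v u - 1 \<le> i" using depth_le[OF u] by simp
        then have "parent G v u \<in> hop_ball G v i"
          using parent_props(2)[OF u] False hop_ball_mono subsetD by metis
        ultimately show ?thesis using Suc by auto
      qed
    qed
    then show ?case using hop_ball_subset[of H G v "Suc i"] by (simp add: H_def del: hop_ball.simps)
  qed simp
  have depths: "depth H v u = depth G v u" if u: "u \<in> hop_ball G v r" for u
  proof (rule antisym)
    have "depth G v u \<le> r" using depth_le[OF u] .
    then show "depth H v u \<le> depth G v u" using balls in_hop_ball_depth[OF u] depth_le by metis
    have uH: "u \<in> hop_ball H v r" using u balls by simp
    then have "depth H v u \<le> r" using depth_le by metis
    then show "depth G v u \<le> depth H v u" using balls in_hop_ball_depth[OF uH] depth_le by metis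
  qed
  have "parent H v u = parent G v u" if u: "u \<in> hop_ball G v r" "u \<noteq> v" for u
  proof -
    have le: "depth G v u - 1 \<le> r" using depth_le[OF u(1)] by simp
    show ?thesis unfolding parent_def[of H]
    proof (rule Least_equality)
      show "{u, parent G v u} \<in> H \<and> parent G v u \<in> hop_ball H v (depth H v u - 1)"
        using keep[OF u] parent_props(2)[OF u] depths[OF u(1)] balls[OF le] by simp
    next
      fix w assume "{u, w} \<in> H \<and> w \<in> hop_ball H v (depth H v u - 1)"
      then have "{u, w} \<in> G \<and> w \<in> hop_ball G v (depth G v u - 1)"
        using depths[OF u(1)] balls[OF le] by (simp add: H_def)
      then show "parent G v u \<le> w" unfolding parent_def by (rule Least_le)
    qed
  qed
  then show ?thesis unfolding bfs_tree_def H_def[symmetric] using balls[of r] by auto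
qed

section \<open>Non-tree edges in balls that are not 3-colourable\<close>

text \<open>The elements reached from \<open>A\<close> by at most \<open>r\<close> steps from child to parent, \<open>A\<close> included.\<close>

definition ancestors :: "nat \<Rightarrow> ('a \<times> 'a) set \<Rightarrow> 'a set \<Rightarrow> 'a set" where
  "ancestors r F A = (\<Union>i\<le>r. (F ^^ i) `` A)"

lemma card_relpow_Image:
  fixes F :: "('a \<times> 'a) set"
  assumes "single_valued F" "finite A"
  shows "finite ((F ^^ i) `` A) \<and> card ((F ^^ i) `` A) \<le> card A"
proof (induction i)
  case (Suc i)
  define X where "X = (F ^^ i) `` A"
  have "F `` X \<subseteq> (\<lambda>u. THE w. (u, w) \<in> F) ` X"
  proof
    fix w assume "w \<in> F `` X"
    then obtain u where u: "u \<in> X" "(u, w) \<in> F" by blast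
    then have "(THE w. (u, w) \<in> F) = w"
      using assms(1) by (auto simp: single_valued_def)
    then show "w \<in> (\<lambda>u. THE w. (u, w) \<in> F) ` X" using u by blast
  qed
  moreover have "(F ^^ Suc i) `` A = F `` X" by (auto simp: X_def)
  ultimately show ?case using Suc
    by (metis (no_types, lifting) X_def card_image_le card_mono finite_imageI finite_subset le_trans)
qed (use assms in simp)

lemma card_ancestors:
  assumes "single_valued F" "finite A"
  shows "finite (ancestors r F A)" "card (ancestors r F A) \<le> (r + 1) * card A"
proof -
  show "finite (ancestors r F A)"
    using card_relpow_Image[OF assms] by (auto simp: ancestors_def)
  have "card (ancestors r F A) \<le> (\<Sum>i\<le>r. card ((F ^^ i) `` A))"
    unfolding ancestors_def by (rule card_UN_le) simp
  also have "\<dots> \<le> (\<Sum>i\<le>r. card A)"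
    by (rule sum_mono) (use card_relpow_Image[OF assms] in auto)
  finally show "card (ancestors r F A) \<le> (r + 1) * card A" by simp
qed

text \<open>
  The pairs that join an element of \<open>A\<close> to an ancestor of \<open>A\<close>. The singletons that arise from
  \<open>a = t\<close> are harmless, since only upper bounds on the number of pairs are needed.
\<close>

definition candidate_pairs :: "nat \<Rightarrow> ('a \<times> 'a) set \<Rightarrow> 'a set \<Rightarrow> 'a set set" where
  "candidate_pairs r F A = (\<lambda>(a, t). {a, t}) ` (A \<times> ancestors r F A)"

lemma card_candidate_pairs:
  assumes "single_valued F" "finite A"
  shows "finite (candidate_pairs r F A)" "card (candidate_pairs r F A) \<le> (r + 1) * (card A)\<^sup>2"
proof -
  show "finite (candidate_pairs r F A)"
    using card_ancestors(1)[OF assms] assms(2) by (auto simp: candidate_pairs_def)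
  have "card (candidate_pairs r F A) \<le> card A * card (ancestors r F A)"
    unfolding candidate_pairs_def
    using card_image_le[of "A \<times> ancestors r F A"] card_ancestors(1)[OF assms] assms(2)
    by (metis card_cartesian_product finite_SigmaI)
  also have "\<dots> \<le> card A * ((r + 1) * card A)"
    by (rule mult_left_mono[OF card_ancestors(2)[OF assms]]) simp
  finally show "card (candidate_pairs r F A) \<le> (r + 1) * (card A)\<^sup>2"
    by (simp add: power2_eq_square algebra_simps)
qed

text \<open>
  The configurations that occur when the ball with search tree \<open>F\<close> and root \<open>v\<close> is not
  3-colourable: a nonempty set \<open>A\<close> of vertices of the ball and as many non-tree pairs between \<open>A\<close>
  and its ancestors. They depend on the tree only.
\<close>

definition excess_witnesses :: "nat \<Rightarrow> 'a \<Rightarrow> ('a \<times> 'a) set \<Rightarrow> ('a set \<times> 'a set set) set" where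
  "excess_witnesses r v F = {(A, Q). A \<subseteq> insert v (Domain F) \<and> A \<noteq> {} \<and>
     Q \<subseteq> candidate_pairs r F A \<and> Q \<inter> tree_edges F = {} \<and> card Q = card A}"

lemma excess_witness_exists:
  assumes "G \<subseteq> all_pairs V" "finite V" "v \<in> V"
    and "\<not> three_colorable_on G (hop_ball G v r)"
  obtains A Q where "(A, Q) \<in> excess_witnesses r v (bfs_tree r G v)" "Q \<subseteq> G"
proof -
  define F where "F = bfs_tree r G v"
  have finB: "finite (hop_ball G v r)"
    using hop_ball_within[OF assms(1,3)] assms(2) finite_subset by blast
  obtain T where T: "T \<subseteq> hop_ball G v r" "T \<noteq> {}"
    and deg: "\<And>u. u \<in> T \<Longrightarrow> 3 \<le> card {w \<in> T. {u, w} \<in> G}"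
    using minimal_not_three_colorable[OF finB assms(4,1)] by metis
  have finT: "finite T" using T(1) finB finite_subset by blast
  define A where "A = {u \<in> T. \<not> (\<exists>w\<in>T. (w, u) \<in> F)}"
  have finA: "finite A" using finT by (simp add: A_def)
  \<comment> \<open>Following children within \<open>T\<close> from \<open>u\<close> ends in \<open>A\<close>, since each step increases the depth.\<close>
  have reach: "\<exists>i\<le>r - depth G v u. \<exists>a\<in>A. (a, u) \<in> F ^^ i" if "u \<in> T" for u
    using that
  proof (induction "r - depth G v u" arbitrary: u rule: less_induct)
    case less
    show ?case
    proof (cases "u \<in> A")
      case True
      then show ?thesis by (intro exI[of _ 0]) auto
    next
      case False
      then obtain w where w: "w \<in> T" "(w, u) \<in> F" using less.prems by (auto simp: A_def)
      have d: "depth G v u < depth G v w" "depth G v w \<le> r"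
        using depth_child w(2) by (auto simp: F_def)
      then obtain i a where i: "i \<le> r - depth G v w" "a \<in> A" "(a, w) \<in> F ^^ i"
        using less.hyps[of w] w(1) by (metis diff_less_mono2 less_le_trans)
      then have "(a, u) \<in> F ^^ Suc i" using w(2) by auto
      then show ?thesis using i d by (intro exI[of _ "Suc i"]) auto
    qed
  qed
  then have TA: "T \<subseteq> ancestors r F A"
    unfolding ancestors_def by (fastforce intro: le_trans)
  have "A \<noteq> {}" using reach T(2) by blast
  define R where "R = {{a, t} | a t. a \<in> A \<and> t \<in> T \<and> {a, t} \<in> G \<and> {a, t} \<notin> tree_edges F}"
  have RG: "R \<subseteq> G" and RF: "R \<inter> tree_edges F = {}" by (auto simp: R_def)
  have Rc: "R \<subseteq> candidate_pairs r F A"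
    using TA by (fastforce simp: R_def candidate_pairs_def)
  have finR: "finite R"
    using Rc card_candidate_pairs(1)[OF _ finA] single_valued_bfs_tree finite_subset
    unfolding F_def by metis
  \<comment> \<open>Among the at least three neighbours in \<open>T\<close> of a vertex without child in \<open>T\<close>, at most one,
     its parent, is joined to it by a tree edge.\<close>
  have two: "2 \<le> card {e \<in> R. a \<in> e}" if a: "a \<in> A" for a
  proof -
    define N where "N = {w \<in> T. {a, w} \<in> G}"
    have N: "finite N" "3 \<le> card N" using deg a finT by (auto simp: A_def N_def)
    have "(\<lambda>w. {a, w}) ` (N - {parent G v a}) \<subseteq> {e \<in> R. a \<in> e}"
    proof
      fix e assume "e \<in> (\<lambda>w. {a, w}) ` (N - {parent G v a})"
      then obtain w where w: "e = {a, w}" "w \<in> T" "{a, w} \<in> G" "w \<noteq> parent G v a"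
        by (auto simp: N_def)
      have "(w, a) \<notin> F" using a w by (auto simp: A_def)
      moreover have "(a, w) \<notin> F" using w by (auto simp: F_def bfs_tree_def)
      ultimately have "{a, w} \<notin> tree_edges F" by (auto simp: tree_edges_def doubleton_eq_iff)
      then show "e \<in> {e \<in> R. a \<in> e}" using w a by (auto simp: R_def)
    qed
    moreover have "inj_on (\<lambda>w. {a, w}) (N - {parent G v a})"
      by (auto simp: inj_on_def doubleton_eq_iff)
    moreover have "finite {e \<in> R. a \<in> e}" using finR by simp
    ultimately have "card (N - {parent G v a}) \<le> card {e \<in> R. a \<in> e}"
      by (intro card_inj_on_le)
    moreover have "card N - 1 \<le> card (N - {parent G v a})"
      using N(1) by (simp add: card_Diff_singleton_if)
    ultimately show ?thesis using N(2) by simp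
  qed
  \<comment> \<open>Double counting of the pairs of an element of \<open>A\<close> and an edge in \<open>R\<close> that contains it.\<close>
  have "2 * card A \<le> (\<Sum>a\<in>A. card {e \<in> R. a \<in> e})"
    using sum_bounded_below[of A 2 "\<lambda>a. card {e \<in> R. a \<in> e}"] two by (simp add: mult.commute)
  also have "\<dots> = (\<Sum>a\<in>A. \<Sum>e\<in>R. if a \<in> e then 1 else 0)"
    using finR by (simp add: sum.If_cases Int_def)
  also have "\<dots> = (\<Sum>e\<in>R. card (A \<inter> e))"
    using finA by (subst sum.swap) (simp add: sum.If_cases Int_def)
  also have "\<dots> \<le> (\<Sum>e\<in>R. 2)"
  proof (rule sum_mono)
    fix e assume "e \<in> R"
    then have "card e = 2" using RG assms(1) by (auto simp: all_pairs_def)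
    then show "card (A \<inter> e) \<le> 2"
      by (metis Int_lower2 card.infinite card_mono zero_neq_numeral)
  qed
  finally have "card A \<le> card R" by simp
  then obtain Q where Q: "Q \<subseteq> R" "card Q = card A" using obtain_subset_with_card_n by metis
  have "A \<subseteq> insert v (Domain F)"
    using T(1) insert_Domain_bfs_tree[of v r G] by (auto simp: A_def F_def)
  then have "(A, Q) \<in> excess_witnesses r v F"
    using Q Rc RF \<open>A \<noteq> {}\<close> unfolding excess_witnesses_def by blast
  then show ?thesis using that Q(1) RG unfolding F_def by blast
qed

lemma card_hop_ball:
  assumes "G \<subseteq> all_pairs V" "finite V" "v \<in> V"
    and "\<And>w. w \<in> V \<Longrightarrow> card {e \<in> G. w \<in> e} \<le> \<Delta>"
  shows "card (hop_ball G v i) \<le> (\<Delta> + 1) ^ i"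
proof (induction i)
  case (Suc i)
  define B where "B = hop_ball G v i"
  have BV: "B \<subseteq> V" using hop_ball_within[OF assms(1,3)] by (simp add: B_def)
  have finB: "finite B" using BV assms(2) finite_subset by blast
  have finG: "finite G" using assms(1,2) finite_all_pairs finite_subset by blast
  have nb: "card {u. {u, w} \<in> G} \<le> \<Delta> \<and> finite {u. {u, w} \<in> G}" if "w \<in> V" for w
  proof -
    have inj: "inj_on (\<lambda>u. {u, w}) {u. {u, w} \<in> G}"
      by (auto simp: inj_on_def doubleton_eq_iff)
    have sub: "(\<lambda>u. {u, w}) ` {u. {u, w} \<in> G} \<subseteq> {e \<in> G. w \<in> e}" by auto
    have fin: "finite {e \<in> G. w \<in> e}" using finG by simp
    show ?thesis
      using card_inj_on_le[OF inj sub fin] inj_on_finite[OF inj sub fin] assms(4)[OF that] by simp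
  qed
  have eq: "hop_ball G v (Suc i) = B \<union> (\<Union>w\<in>B. {u. {u, w} \<in> G})" by (auto simp: B_def)
  have "card (hop_ball G v (Suc i)) \<le> card B + card (\<Union>w\<in>B. {u. {u, w} \<in> G})"
    unfolding eq by (rule card_Un_le)
  also have "card (\<Union>w\<in>B. {u. {u, w} \<in> G}) \<le> (\<Sum>w\<in>B. card {u. {u, w} \<in> G})"
    by (rule card_UN_le[OF finB])
  also have "\<dots> \<le> (\<Sum>w\<in>B. \<Delta>)" by (rule sum_mono) (use nb BV in auto)
  finally have "card (hop_ball G v (Suc i)) \<le> (\<Delta> + 1) * card B"
    by (simp add: algebra_simps del: hop_ball.simps)
  also have "\<dots> \<le> (\<Delta> + 1) * (\<Delta> + 1) ^ i"
    using Suc unfolding B_def by (rule mult_left_mono) simp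
  finally show ?case by (simp del: hop_ball.simps)
qed simp

section \<open>Weights of families of edge sets\<close>

lemma sum_Pow_prod:
  fixes f :: "'a \<Rightarrow> 'b::comm_semiring_1"
  assumes "finite E"
  shows "(\<Sum>G\<in>Pow E. \<Prod>e\<in>G. f e) = (\<Prod>e\<in>E. f e + 1)"
  using prod_add[OF assms, of f "\<lambda>_. 1"] by simp

lemma sum_Pow_power_card:
  fixes x :: "'b::comm_semiring_1"
  assumes "finite E"
  shows "(\<Sum>G\<in>Pow E. x ^ card G) = (x + 1) ^ card E"
  using sum_Pow_prod[OF assms, of "\<lambda>_. x"] by simp

lemma sum_UN_le:
  fixes f :: "'a \<Rightarrow> 'b::ordered_comm_monoid_add"
  assumes "finite I" "\<And>i. i \<in> I \<Longrightarrow> finite (P i)" "\<And>x. 0 \<le> f x"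
  shows "sum f (\<Union>i\<in>I. P i) \<le> (\<Sum>i\<in>I. sum f (P i))"
proof -
  have "(\<Union>i\<in>I. P i) = snd ` (SIGMA i:I. P i)" by force
  then have "sum f (\<Union>i\<in>I. P i) \<le> sum (f \<circ> snd) (SIGMA i:I. P i)"
    using assms(1,2) by (simp add: sum_image_le[OF finite_SigmaI] assms(3) del: o_apply)
  also have "\<dots> = (\<Sum>i\<in>I. sum f (P i))"
    using assms by (subst sum.Sigma) (auto simp: case_prod_unfold)
  finally show ?thesis .
qed

lemma card_incident_pairs:
  assumes "finite V"
  shows "card {e \<in> all_pairs V. v \<in> e} \<le> card V"
proof -
  have "{e \<in> all_pairs V. v \<in> e} \<subseteq> (\<lambda>w. {v, w}) ` V"
    by (auto simp: all_pairs_def card_2_iff)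
  then show ?thesis using assms by (meson card_image_le card_mono finite_imageI le_trans)
qed

text \<open>Markov's inequality for \<open>(1 + \<theta>)\<close> to the power of the degree of \<open>v\<close>.\<close>

lemma weight_high_degree:
  fixes x \<theta> :: real
  assumes "finite V" "x \<ge> 0" "\<theta> \<ge> 0"
  shows "(\<Sum>G | G \<subseteq> all_pairs V \<and> \<Delta> < card {e \<in> G. v \<in> e}. x ^ card G) * (1 + \<theta>) ^ (\<Delta> + 1)
    \<le> (1 + x) ^ card (all_pairs V) * (1 + \<theta> * (x / (1 + x))) ^ card V"
proof -
  define E where "E = all_pairs V"
  define Ev where "Ev = {e \<in> E. v \<in> e}"
  have finE: "finite E" using assms(1) by (simp add: E_def)
  have moment: "x ^ card G * (1 + \<theta>) ^ card {e \<in> G. v \<in> e}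
      = (\<Prod>e\<in>G. x * (if v \<in> e then 1 + \<theta> else 1))" if "G \<subseteq> E" for G
    using finite_subset[OF that finE] by (simp add: prod.distrib prod.If_cases Int_def)
  have "(\<Sum>G | G \<subseteq> E \<and> \<Delta> < card {e \<in> G. v \<in> e}. x ^ card G) * (1 + \<theta>) ^ (\<Delta> + 1)
      = (\<Sum>G | G \<subseteq> E \<and> \<Delta> < card {e \<in> G. v \<in> e}. x ^ card G * (1 + \<theta>) ^ (\<Delta> + 1))"
    by (rule sum_distrib_right)
  also have "\<dots> \<le> (\<Sum>G | G \<subseteq> E \<and> \<Delta> < card {e \<in> G. v \<in> e}.
      x ^ card G * (1 + \<theta>) ^ card {e \<in> G. v \<in> e})"
    using assms by (intro sum_mono mult_left_mono power_increasing) auto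
  also have "\<dots> \<le> (\<Sum>G\<in>Pow E. x ^ card G * (1 + \<theta>) ^ card {e \<in> G. v \<in> e})"
    using assms finE by (intro sum_mono2) auto
  also have "\<dots> = (\<Sum>G\<in>Pow E. \<Prod>e\<in>G. x * (if v \<in> e then 1 + \<theta> else 1))"
    by (intro sum.cong refl moment) auto
  also have "\<dots> = (\<Prod>e\<in>E. x * (if v \<in> e then 1 + \<theta> else 1) + 1)"
    by (rule sum_Pow_prod[OF finE])
  also have "\<dots> = (\<Prod>e\<in>E. (1 + x) * (if v \<in> e then 1 + \<theta> * (x / (1 + x)) else 1))"
  proof (rule prod.cong[OF refl])
    fix e
    have "(1 + x) * (x / (1 + x)) = x" using assms(2) by simp
    then have "(1 + x) * (1 + \<theta> * (x / (1 + x))) = x * (1 + \<theta>) + 1"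
      by (simp only: distrib_left mult.left_commute[of "1 + x" \<theta>]) simp
    then show "x * (if v \<in> e then 1 + \<theta> else 1) + 1
        = (1 + x) * (if v \<in> e then 1 + \<theta> * (x / (1 + x)) else 1)"
      by simp
  qed
  also have "\<dots> = (1 + x) ^ card E * (1 + \<theta> * (x / (1 + x))) ^ card Ev"
    using finE by (simp add: prod.distrib prod.If_cases Int_def Ev_def)
  also have "\<dots> \<le> (1 + x) ^ card E * (1 + \<theta> * (x / (1 + x))) ^ card V"
    using assms card_incident_pairs[OF assms(1), of v]
    by (intro mult_left_mono power_increasing) (auto simp: Ev_def E_def)
  finally show ?thesis by (simp add: E_def)
qed

lemma weight_independent_set:
  fixes x :: real
  assumes "finite V" "x \<ge> 0"
  shows "(\<Sum>G | G \<subseteq> all_pairs V \<and> (\<exists>S\<subseteq>V. card S = s \<and> G \<inter> all_pairs S = {}). x ^ card G)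
    \<le> real (card V choose s) * ((1 + x) ^ card (all_pairs V) / (1 + x) ^ (s choose 2))"
proof -
  define E where "E = all_pairs V"
  define \<S> where "\<S> = {S. S \<subseteq> V \<and> card S = s}"
  have finE: "finite E" using assms(1) by (simp add: E_def)
  have finS: "finite \<S>" using assms(1) by (simp add: \<S>_def)
  have one: "(\<Sum>G\<in>Pow (E - all_pairs S). x ^ card G) = (1 + x) ^ card E / (1 + x) ^ (s choose 2)"
    if "S \<in> \<S>" for S
  proof -
    have S: "S \<subseteq> V" "card S = s" "finite S"
      using that assms(1) finite_subset by (auto simp: \<S>_def)
    have sub: "all_pairs S \<subseteq> E" using all_pairs_mono[OF S(1)] by (simp add: E_def)
    have c: "card E = card (E - all_pairs S) + (s choose 2)"
      using card_all_pairs[OF S(3)] S(2,3) card_Diff_subset[OF _ sub] card_mono[OF finE sub]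
      by simp
    have "(\<Sum>G\<in>Pow (E - all_pairs S). x ^ card G) = (x + 1) ^ card (E - all_pairs S)"
      by (rule sum_Pow_power_card) (use finE in auto)
    then show ?thesis using assms(2) unfolding c power_add by (simp add: add.commute)
  qed
  have "{G. G \<subseteq> all_pairs V \<and> (\<exists>S\<subseteq>V. card S = s \<and> G \<inter> all_pairs S = {})}
      = (\<Union>S\<in>\<S>. Pow (E - all_pairs S))"
    by (auto simp: \<S>_def E_def)
  then have "(\<Sum>G | G \<subseteq> all_pairs V \<and> (\<exists>S\<subseteq>V. card S = s \<and> G \<inter> all_pairs S = {}). x ^ card G)
      = sum (\<lambda>G. x ^ card G) (\<Union>S\<in>\<S>. Pow (E - all_pairs S))" by simp
  also have "\<dots> \<le> (\<Sum>S\<in>\<S>. \<Sum>G\<in>Pow (E - all_pairs S). x ^ card G)"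
    using finS finE assms(2) by (intro sum_UN_le) auto
  also have "\<dots> = (\<Sum>S\<in>\<S>. (1 + x) ^ card E / (1 + x) ^ (s choose 2))"
    by (rule sum.cong[OF refl one])
  also have "\<dots> = real (card V choose s) * ((1 + x) ^ card E / (1 + x) ^ (s choose 2))"
    using n_subsets[OF assms(1), of s] by (simp add: \<S>_def)
  finally show ?thesis by (simp add: E_def)
qed

text \<open>
  Given the search tree, prescribing non-tree edges costs a factor \<open>x\<close> for each of them: deleting
  them is an injection into the graphs with the same tree.
\<close>

lemma weight_fixed_bfs_tree:
  fixes x :: real
  assumes "finite E" "x \<ge> 0" "Q \<inter> tree_edges F = {}"
  shows "(\<Sum>G | G \<subseteq> E \<and> bfs_tree r G v = F \<and> Q \<subseteq> G. x ^ card G)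
    \<le> x ^ card Q * (\<Sum>G | G \<subseteq> E \<and> bfs_tree r G v = F. x ^ card G)"
proof -
  define \<A> where "\<A> = {G. G \<subseteq> E \<and> bfs_tree r G v = F \<and> Q \<subseteq> G}"
  define \<B> where "\<B> = {G. G \<subseteq> E \<and> bfs_tree r G v = F}"
  have finB: "finite \<B>" using assms(1) by (simp add: \<B>_def)
  have inj: "inj_on (\<lambda>G. G - Q) \<A>" unfolding inj_on_def \<A>_def by blast
  have sub: "(\<lambda>G. G - Q) ` \<A> \<subseteq> \<B>"
  proof
    fix H assume "H \<in> (\<lambda>G. G - Q) ` \<A>"
    then obtain G where G: "G \<subseteq> E" "bfs_tree r G v = F" "H = G - Q" by (auto simp: \<A>_def)
    then show "H \<in> \<B>" using bfs_tree_Diff[of Q r G v] assms(3) by (auto simp: \<B>_def)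
  qed
  have "x ^ card G = x ^ card Q * x ^ card (G - Q)" if "G \<in> \<A>" for G
  proof -
    have G: "Q \<subseteq> G" "finite G" "finite Q"
      using that finite_subset[OF _ assms(1)] by (auto simp: \<A>_def)
    then have "card G = card Q + card (G - Q)"
      using card_Diff_subset[OF G(3,1)] card_mono[OF G(2,1)] by simp
    then show ?thesis by (simp add: power_add)
  qed
  then have "(\<Sum>G\<in>\<A>. x ^ card G) = (\<Sum>G\<in>\<A>. x ^ card Q * x ^ card (G - Q))"
    by (intro sum.cong) auto
  also have "\<dots> = x ^ card Q * (\<Sum>H\<in>(\<lambda>G. G - Q) ` \<A>. x ^ card H)"
    using inj by (simp add: sum.reindex sum_distrib_left)
  also have "\<dots> \<le> x ^ card Q * (\<Sum>H\<in>\<B>. x ^ card H)"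
    using assms(2) finB sub by (intro mult_left_mono sum_mono2) auto
  finally show ?thesis by (simp add: \<A>_def \<B>_def)
qed

lemma sum_Pow_card:
  fixes g :: "nat \<Rightarrow> 'b::semiring_1"
  assumes "finite B"
  shows "(\<Sum>A\<in>Pow B. g (card A)) = (\<Sum>k\<le>card B. of_nat (card B choose k) * g k)"
proof -
  have "(\<Sum>A\<in>Pow B. g (card A)) = (\<Sum>k\<le>card B. \<Sum>A\<in>{A \<in> Pow B. card A = k}. g (card A))"
    by (rule sum.group[symmetric]) (use assms card_mono in auto)
  also have "\<dots> = (\<Sum>k\<le>card B. of_nat (card B choose k) * g k)"
    using n_subsets[OF assms] by (intro sum.cong refl) simp
  finally show ?thesis .
qed

lemma weight_excess_witnesses:
  fixes x :: real
  assumes "x \<ge> 0" "single_valued F" "finite F"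
  shows "finite (excess_witnesses r v F)"
    and "(\<Sum>(A, Q)\<in>excess_witnesses r v F. x ^ card Q)
    \<le> (\<Sum>k = 1..card (insert v (Domain F)). real (card (insert v (Domain F)) choose k) *
          (real ((r + 1) * k\<^sup>2 choose k) * x ^ k))"
proof -
  define B where "B = insert v (Domain F)"
  have finB: "finite B" using finite_Domain[OF assms(3)] by (simp add: B_def)
  define T where "T = (\<lambda>A. {Q. Q \<subseteq> candidate_pairs r F A \<and> card Q = card A})"
  define S where "S = (SIGMA A:Pow B - {{}}. T A)"
  have cand: "finite (candidate_pairs r F A)" "card (candidate_pairs r F A) \<le> (r + 1) * (card A)\<^sup>2"
    if "A \<subseteq> B" for A
    using card_candidate_pairs[OF assms(2)] finite_subset[OF that finB] by auto
  have finT: "finite (T A)" if "A \<subseteq> B" for A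
    using cand(1)[OF that] by (simp add: T_def)
  have finS: "finite S" using finB finT by (auto simp: S_def)
  have sub: "excess_witnesses r v F \<subseteq> S"
    by (auto simp: excess_witnesses_def S_def T_def B_def)
  then show "finite (excess_witnesses r v F)" using finS finite_subset by blast
  have "(\<Sum>(A, Q)\<in>excess_witnesses r v F. x ^ card Q) \<le> (\<Sum>(A, Q)\<in>S. x ^ card Q)"
    using finS sub assms(1) by (intro sum_mono2) auto
  also have "\<dots> = (\<Sum>A\<in>Pow B - {{}}. \<Sum>Q\<in>T A. x ^ card Q)"
    unfolding S_def by (rule sum.Sigma[symmetric]) (use finB finT in auto)
  also have "\<dots> \<le> (\<Sum>A\<in>Pow B - {{}}. real ((r + 1) * (card A)\<^sup>2 choose card A) * x ^ card A)"
  proof (rule sum_mono)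
    fix A assume A: "A \<in> Pow B - {{}}"
    have "(\<Sum>Q\<in>T A. x ^ card Q) = real (card (T A)) * x ^ card A" by (simp add: T_def)
    also have "card (T A) = card (candidate_pairs r F A) choose card A"
      unfolding T_def by (rule n_subsets) (use cand A in auto)
    also have "real (card (candidate_pairs r F A) choose card A) * x ^ card A
        \<le> real ((r + 1) * (card A)\<^sup>2 choose card A) * x ^ card A"
      using cand(2)[of A] A assms(1) by (intro mult_right_mono) (auto intro: binomial_right_mono)
    finally show "(\<Sum>Q\<in>T A. x ^ card Q) \<le> real ((r + 1) * (card A)\<^sup>2 choose card A) * x ^ card A" .
  qed
  also have "\<dots> = (\<Sum>A\<in>Pow B. if card A = 0 then 0
      else real ((r + 1) * (card A)\<^sup>2 choose card A) * x ^ card A)"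
    using finB finite_subset by (intro sum.mono_neutral_cong_left) (auto simp: card_eq_0_iff)
  also have "\<dots> = (\<Sum>k\<le>card B. real (card B choose k) *
      (if k = 0 then 0 else real ((r + 1) * k\<^sup>2 choose k) * x ^ k))"
    by (rule sum_Pow_card[OF finB])
  also have "\<dots> = (\<Sum>k = 1..card B. real (card B choose k) *
      (real ((r + 1) * k\<^sup>2 choose k) * x ^ k))"
    by (intro sum.mono_neutral_cong_right) auto
  finally show "(\<Sum>(A, Q)\<in>excess_witnesses r v F. x ^ card Q)
    \<le> (\<Sum>k = 1..card (insert v (Domain F)). real (card (insert v (Domain F)) choose k) *
          (real ((r + 1) * k\<^sup>2 choose k) * x ^ k))" by (simp add: B_def)
qed

text \<open>
  The union bound over the excess witnesses, carried out separately for each search tree, with the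
  total weight as normalisation. Only balls with at most \<open>M\<close> vertices are considered.
\<close>

lemma weight_bad_ball:
  fixes x \<beta> :: real and V :: "'a::wellorder set"
  assumes "finite V" "v \<in> V" "x \<ge> 0" "\<beta> \<ge> 0"
    and \<beta>: "\<And>N. N \<le> M \<Longrightarrow>
      (\<Sum>k = 1..N. real (N choose k) * (real ((r + 1) * k\<^sup>2 choose k) * x ^ k)) \<le> \<beta>"
  shows "(\<Sum>G | G \<subseteq> all_pairs V \<and> card (hop_ball G v r) \<le> M \<and>
           \<not> three_colorable_on G (hop_ball G v r). x ^ card G)
    \<le> \<beta> * (1 + x) ^ card (all_pairs V)"
proof -
  define E where "E = all_pairs V"
  have finE: "finite E" using assms(1) by (simp add: E_def)
  define \<G> where "\<G> = {G. G \<subseteq> E \<and> card (hop_ball G v r) \<le> M}"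
  have finG: "finite \<G>" using finE by (simp add: \<G>_def)
  define \<F> where "\<F> = (\<lambda>G. bfs_tree r G v) ` \<G>"
  have finF: "finite \<F>" using finG by (simp add: \<F>_def)
  define X where "X = (\<lambda>F. excess_witnesses r v F)"
  have tree: "single_valued F" "finite F" "card (insert v (Domain F)) \<le> M" if F: "F \<in> \<F>" for F
  proof -
    obtain G where G: "G \<subseteq> E" "card (hop_ball G v r) \<le> M" "F = bfs_tree r G v"
      using F by (auto simp: \<F>_def \<G>_def)
    show "single_valued F" using single_valued_bfs_tree G(3) by simp
    have "finite (hop_ball G v r)"
      using hop_ball_within[of G V v r] G(1) assms(1,2) finite_subset by (auto simp: E_def)
    then show "finite F" using G(3) by (simp add: bfs_tree_def)
    show "card (insert v (Domain F)) \<le> M" using G insert_Domain_bfs_tree[of v r G] by simp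
  qed
  have fibre: "{G \<in> \<G>. bfs_tree r G v = F} = {G. G \<subseteq> E \<and> bfs_tree r G v = F}" if "F \<in> \<F>" for F
    using tree(3)[OF that] insert_Domain_bfs_tree[of v r] by (auto simp: \<G>_def)
  have W: "(\<Sum>G | G \<subseteq> E \<and> bfs_tree r G v = F. \<Sum>(A, Q)\<in>X F. if Q \<subseteq> G then x ^ card G else 0)
      \<le> \<beta> * (\<Sum>G | G \<subseteq> E \<and> bfs_tree r G v = F. x ^ card G)" if F: "F \<in> \<F>" for F
  proof -
    define c where "c = (\<Sum>G | G \<subseteq> E \<and> bfs_tree r G v = F. x ^ card G)"
    have c: "c \<ge> 0" using assms(3) by (auto simp: c_def intro: sum_nonneg)
    have "(\<Sum>G | G \<subseteq> E \<and> bfs_tree r G v = F. \<Sum>(A, Q)\<in>X F. if Q \<subseteq> G then x ^ card G else 0)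
        = (\<Sum>(A, Q)\<in>X F. \<Sum>G | G \<subseteq> E \<and> bfs_tree r G v = F. if Q \<subseteq> G then x ^ card G else 0)"
      by (subst sum.swap) (auto simp: case_prod_unfold intro!: sum.cong)
    also have "\<dots> \<le> (\<Sum>(A, Q)\<in>X F. x ^ card Q * c)"
    proof (rule sum_mono, clarify)
      fix A Q assume "(A, Q) \<in> X F"
      then have Q: "Q \<inter> tree_edges F = {}" by (simp add: X_def excess_witnesses_def)
      have "(\<Sum>G | G \<subseteq> E \<and> bfs_tree r G v = F. if Q \<subseteq> G then x ^ card G else 0)
          = (\<Sum>G | G \<subseteq> E \<and> bfs_tree r G v = F \<and> Q \<subseteq> G. x ^ card G)"
        using finE by (intro sum.mono_neutral_cong_right) auto
      also have "\<dots> \<le> x ^ card Q * c"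
        unfolding c_def by (rule weight_fixed_bfs_tree[OF finE assms(3) Q])
      finally show "(\<Sum>G | G \<subseteq> E \<and> bfs_tree r G v = F. if Q \<subseteq> G then x ^ card G else 0)
          \<le> x ^ card Q * c" .
    qed
    also have "\<dots> = (\<Sum>(A, Q)\<in>X F. x ^ card Q) * c"
      by (simp add: sum_distrib_right case_prod_unfold)
    also have "\<dots> \<le> \<beta> * c"
      using weight_excess_witnesses(2)[OF assms(3) tree(1,2)[OF F], where r = r and v = v]
        \<beta>[OF tree(3)[OF F]] c
      unfolding X_def by (intro mult_right_mono) linarith+
    finally show ?thesis by (simp add: c_def)
  qed
  define \<B> where "\<B> = {G \<in> \<G>. \<not> three_colorable_on G (hop_ball G v r)}"
  have "(\<Sum>G\<in>\<B>. x ^ card G)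
      \<le> (\<Sum>G\<in>\<B>. \<Sum>(A, Q)\<in>X (bfs_tree r G v). if Q \<subseteq> G then x ^ card G else 0)"
  proof (rule sum_mono)
    fix G assume G: "G \<in> \<B>"
    then have GE: "G \<subseteq> all_pairs V" and nc: "\<not> three_colorable_on G (hop_ball G v r)"
      and GG: "G \<in> \<G>" by (auto simp: \<B>_def \<G>_def E_def)
    obtain A Q where AQ: "(A, Q) \<in> X (bfs_tree r G v)" "Q \<subseteq> G"
      using excess_witness_exists[OF GE assms(1,2) nc] unfolding X_def by metis
    have F: "bfs_tree r G v \<in> \<F>" using GG by (auto simp: \<F>_def)
    have fin: "finite (X (bfs_tree r G v))"
      using weight_excess_witnesses(1)[OF assms(3) tree(1,2)[OF F]] by (simp add: X_def)
    have "x ^ card G = (\<lambda>(A, Q). if Q \<subseteq> G then x ^ card G else 0) (A, Q)" using AQ by simp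
    also have "\<dots> \<le> (\<Sum>(A, Q)\<in>X (bfs_tree r G v). if Q \<subseteq> G then x ^ card G else 0)"
      by (rule member_le_sum[OF AQ(1) _ fin]) (use assms(3) in \<open>simp add: case_prod_unfold\<close>)
    finally show "x ^ card G
        \<le> (\<Sum>(A, Q)\<in>X (bfs_tree r G v). if Q \<subseteq> G then x ^ card G else 0)" .
  qed
  also have "\<dots> \<le> (\<Sum>G\<in>\<G>. \<Sum>(A, Q)\<in>X (bfs_tree r G v). if Q \<subseteq> G then x ^ card G else 0)"
    using finG assms(3) by (intro sum_mono2) (auto simp: \<B>_def intro!: sum_nonneg)
  also have "\<dots> = (\<Sum>F\<in>\<F>. \<Sum>G\<in>{G \<in> \<G>. bfs_tree r G v = F}.
      \<Sum>(A, Q)\<in>X (bfs_tree r G v). if Q \<subseteq> G then x ^ card G else 0)"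
    unfolding \<F>_def by (rule sum.image_gen[OF finG])
  also have "\<dots> = (\<Sum>F\<in>\<F>. \<Sum>G | G \<subseteq> E \<and> bfs_tree r G v = F.
      \<Sum>(A, Q)\<in>X F. if Q \<subseteq> G then x ^ card G else 0)"
    using fibre by (intro sum.cong) auto
  also have "\<dots> \<le> (\<Sum>F\<in>\<F>. \<beta> * (\<Sum>G | G \<subseteq> E \<and> bfs_tree r G v = F. x ^ card G))"
    by (rule sum_mono[OF W])
  also have "\<dots> = \<beta> * (\<Sum>F\<in>\<F>. \<Sum>G\<in>{G \<in> \<G>. bfs_tree r G v = F}. x ^ card G)"
    using fibre by (simp add: sum_distrib_left)
  also have "\<dots> = \<beta> * (\<Sum>G\<in>\<G>. x ^ card G)"
    unfolding \<F>_def by (subst sum.image_gen[OF finG, symmetric]) simp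
  also have "\<dots> \<le> \<beta> * (\<Sum>G\<in>Pow E. x ^ card G)"
    using assms(3,4) finE by (intro mult_left_mono sum_mono2) (auto simp: \<G>_def)
  also have "\<dots> = \<beta> * (1 + x) ^ card E" using sum_Pow_power_card[OF finE, of x] by (simp add: add.commute)
  finally show ?thesis by (simp add: \<B>_def \<G>_def E_def conj_assoc)
qed

section \<open>A random graph\<close>

lemma self_power_le_fact_exp: "real (Suc k) ^ Suc k \<le> fact (Suc k) * exp (real k)"
proof (induction k)
  case (Suc k)
  define a where "a = real (Suc k)"
  have a: "a > 0" by (simp add: a_def)
  have "(1 + 1 / a) ^ Suc k \<le> exp (1 / a) ^ Suc k"
    using a by (intro power_mono) auto
  also have "\<dots> = exp 1" using a by (simp add: exp_of_nat_mult[symmetric] a_def del: power_Suc)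
  finally have e: "(1 + 1 / a) ^ Suc k \<le> exp 1" .
  have "real (Suc (Suc k)) = a * (1 + 1 / a)" using a by (simp add: field_simps a_def)
  then have "real (Suc (Suc k)) ^ Suc (Suc k) = real (Suc (Suc k)) * (a ^ Suc k * (1 + 1 / a) ^ Suc k)"
    unfolding power_Suc[of "real (Suc (Suc k))" "Suc k"] by (simp add: power_mult_distrib)
  also have "\<dots> \<le> real (Suc (Suc k)) * ((fact (Suc k) * exp (real k)) * exp 1)"
    using Suc.IH e a by (intro mult_left_mono mult_mono) (auto simp: a_def simp del: power_Suc fact_Suc)
  also have "\<dots> = fact (Suc (Suc k)) * exp (real (Suc k))"
    by (simp add: exp_add[symmetric] mult_ac add.commute)
  finally show ?case .
qed simp

lemma binomial_le_power_over_fact: "real (n choose k) \<le> real n ^ k / fact k"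
proof -
  have "real ((n choose k) * fact k) \<le> real (n ^ k)"
    using binomial_fact_pow[of n k] of_nat_le_iff by blast
  then show ?thesis by (simp add: field_simps)
qed

text \<open>With \<open>y = e\<^sup>2 (r + 1) M x\<close>, each summand is at most \<open>y\<^sup>k / e\<^sup>2\<close>, by \<open>k\<^sup>k \<le> k! e\<^bsup>k-1\<^esup>\<close>.\<close>

lemma excess_sum_bound:
  fixes x :: real
  assumes x: "x \<ge> 0" and small: "exp 2 * real (r + 1) * real M * x \<le> 11 / 20" and "N \<le> M"
  shows "(\<Sum>k = 1..N. real (N choose k) * (real ((r + 1) * k\<^sup>2 choose k) * x ^ k)) \<le> 19 / 100"
proof -
  define y where "y = exp 2 * real (r + 1) * real M * x"
  have y: "0 \<le> y" "y \<le> 11 / 20" using x small by (auto simp: y_def)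
  have summand: "real (N choose k) * (real ((r + 1) * k\<^sup>2 choose k) * x ^ k) \<le> exp (- 2) * y ^ k"
    if k: "k \<ge> 1" for k
  proof -
    obtain j where j: "k = Suc j" using k by (cases k) auto
    have "real (N choose k) \<le> real N ^ k / fact k" by (rule binomial_le_power_over_fact)
    also have "\<dots> \<le> real M ^ k / fact k"
      using assms(3) by (intro divide_right_mono power_mono) auto
    finally have 1: "real (N choose k) \<le> real M ^ k / fact k" .
    have 2: "real ((r + 1) * k\<^sup>2 choose k) \<le> real ((r + 1) * k\<^sup>2) ^ k / fact k"
      by (rule binomial_le_power_over_fact)
    have 3: "real k ^ k / fact k \<le> exp (real k - 1)"
      using self_power_le_fact_exp[of j]
      by (simp add: j pos_divide_le_eq mult.commute del: power_Suc fact_Suc)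
    have "real (N choose k) * (real ((r + 1) * k\<^sup>2 choose k) * x ^ k)
        \<le> (real M ^ k / fact k) * ((real ((r + 1) * k\<^sup>2) ^ k / fact k) * x ^ k)"
      using 1 2 x by (intro mult_mono mult_right_mono) auto
    also have "\<dots> = (real (r + 1) * real M * x) ^ k * (real k ^ k / fact k)\<^sup>2"
    proof -
      have "(M' ^ k / f) * ((a * c\<^sup>2) ^ k / f * x ^ k) = (a * M' * x) ^ k * (c ^ k / f)\<^sup>2"
        for a c f M' :: real
        by (simp add: power_mult_distrib power2_eq_square)
      then show ?thesis by (simp only: of_nat_mult of_nat_power)
    qed
    also have "\<dots> \<le> (real (r + 1) * real M * x) ^ k * (exp (real k - 1))\<^sup>2"
      using 3 x by (intro mult_left_mono power_mono) auto
    also have "(exp (real k - 1))\<^sup>2 = exp (- 2) * exp 2 ^ k"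
      by (simp add: exp_of_nat_mult[symmetric] exp_double[symmetric] exp_add[symmetric] algebra_simps)
    also have "(real (r + 1) * real M * x) ^ k * (exp (- 2) * exp 2 ^ k) = exp (- 2) * y ^ k"
      by (simp add: y_def power_mult_distrib mult_ac)
    finally show ?thesis .
  qed
  have "(\<Sum>k = 1..N. y ^ k) = (\<Sum>k<N. y * y ^ k)"
    by (rule sum.reindex_bij_witness[of _ Suc "\<lambda>k. k - 1"]) (auto simp: power_eq_if)
  also have "\<dots> = y * ((1 - y ^ N) / (1 - y))"
    using y by (simp add: sum_distrib_left[symmetric] sum_gp_strict)
  also have "\<dots> \<le> y * (1 / (1 - y))"
    using y by (intro mult_left_mono divide_right_mono) auto
  also have "\<dots> \<le> 11 / 9" using y by (simp add: field_simps)
  finally have geo: "(\<Sum>k = 1..N. y ^ k) \<le> 11 / 9" .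
  have "13 / 2 \<le> exp (2 :: real)"
  proof -
    have "(13 / 8) ^ 4 \<le> exp (1 / 2 :: real) ^ 4"
      using exp_lower_Taylor_quadratic[of "1 / 2 :: real"]
      by (intro power_mono) (auto simp: power2_eq_square)
    also have "\<dots> = exp 2" by (simp add: exp_of_nat_mult[symmetric])
    finally show ?thesis by (simp add: power4_eq_xxxx)
  qed
  then have e: "exp (- 2 :: real) \<le> 2 / 13" by (simp add: exp_minus field_simps)
  have "(\<Sum>k = 1..N. real (N choose k) * (real ((r + 1) * k\<^sup>2 choose k) * x ^ k))
      \<le> (\<Sum>k = 1..N. exp (- 2) * y ^ k)"
    by (rule sum_mono) (use summand in auto)
  also have "\<dots> = exp (- 2) * (\<Sum>k = 1..N. y ^ k)" by (simp add: sum_distrib_left)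
  also have "\<dots> \<le> 2 / 13 * (11 / 9)" using e geo y by (intro mult_mono sum_nonneg) auto
  finally show ?thesis by simp
qed

text \<open>
  The three assumptions bound the weight of the graphs with a vertex of degree above \<open>\<Delta>\<close>, of those
  with an independent set of size \<open>s\<close>, and of those among the rest in which more than \<open>n/4\<close> balls
  are not 3-colourable. The three shares of the total weight, \<open>1/10\<close>, \<open>1/10\<close> and \<open>76/100\<close>, leave
  room for a graph outside all three classes.
\<close>

lemma exists_sparse_graph:
  fixes x \<theta> :: real
  assumes n: "n > 0" and x: "x \<ge> 0" and \<theta>: "\<theta> \<ge> 0"
    and degrees: "real n * (1 + \<theta> * (x / (1 + x))) ^ n \<le> (1 + \<theta>) ^ (\<Delta> + 1) / 10"
    and independence: "real (n choose s) \<le> (1 + x) ^ (s choose 2) / 10"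
    and excess: "exp 2 * real (r + 1) * real ((\<Delta> + 1) ^ r) * x \<le> 11 / 20"
  obtains G W where "G \<subseteq> all_pairs {..<n}" "W \<subseteq> {..<n}" "3 * n \<le> 4 * card W"
    "\<And>S. S \<subseteq> {..<n} \<Longrightarrow> card S = s \<Longrightarrow> G \<inter> all_pairs S \<noteq> {}"
    "\<And>v. v \<in> W \<Longrightarrow> three_colorable_on G (hop_ball G v r)"
proof -
  define V where "V = {..<n}"
  define E where "E = all_pairs V"
  have finV: "finite V" and cardV: "card V = n" by (auto simp: V_def)
  have finE: "finite E" using finV by (simp add: E_def)
  define w where "w = (\<lambda>G :: nat set set. x ^ card G)"
  have w0: "w G \<ge> 0" for G using x by (simp add: w_def)
  define t where "t = (1 + x) ^ card E"
  have t: "t > 0" using x by (simp add: t_def)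
  have total: "sum w (Pow E) = t"
    unfolding w_def t_def using sum_Pow_power_card[OF finE, of x] by (simp add: add.commute)
  define Bad where "Bad = (\<lambda>G. {v \<in> V. \<not> three_colorable_on G (hop_ball G v r)})"
  define X1 where "X1 = (\<Union>v\<in>V. {G. G \<subseteq> E \<and> \<Delta> < card {e \<in> G. v \<in> e}})"
  define X2 where "X2 = {G. G \<subseteq> E \<and> (\<exists>S\<subseteq>V. card S = s \<and> G \<inter> all_pairs S = {})}"
  define X3 where "X3 = {G. G \<subseteq> E \<and> G \<notin> X1 \<and> n < 4 * card (Bad G)}"
  have fin: "finite X1" "finite X2" "finite X3"
    using finE finV by (auto simp: X1_def X2_def X3_def)
  have "sum w X1 \<le> (\<Sum>v\<in>V. sum w {G. G \<subseteq> E \<and> \<Delta> < card {e \<in> G. v \<in> e}})"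
    unfolding X1_def using finE finV w0 by (intro sum_UN_le) auto
  also have "\<dots> \<le> (\<Sum>v\<in>V. t * (1 + \<theta> * (x / (1 + x))) ^ n / (1 + \<theta>) ^ (\<Delta> + 1))"
  proof (rule sum_mono)
    fix v
    show "sum w {G. G \<subseteq> E \<and> \<Delta> < card {e \<in> G. v \<in> e}}
        \<le> t * (1 + \<theta> * (x / (1 + x))) ^ n / (1 + \<theta>) ^ (\<Delta> + 1)"
      using weight_high_degree[OF finV x \<theta>, of \<Delta> v] \<theta>
      by (simp add: w_def t_def E_def cardV pos_le_divide_eq del: power_Suc)
  qed
  also have "\<dots> = t * ((real n * (1 + \<theta> * (x / (1 + x))) ^ n) / (1 + \<theta>) ^ (\<Delta> + 1))"
    by (simp add: cardV del: power_Suc)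
  also have "\<dots> \<le> t * (1 / 10)"
    using degrees t \<theta> by (intro mult_left_mono) (auto simp: pos_divide_le_eq simp del: power_Suc)
  finally have 1: "sum w X1 \<le> t / 10" by simp
  have "sum w X2 \<le> real (n choose s) * (t / (1 + x) ^ (s choose 2))"
    using weight_independent_set[OF finV x, of s] by (simp add: X2_def w_def t_def E_def cardV)
  also have "\<dots> = t * (real (n choose s) / (1 + x) ^ (s choose 2))" by simp
  also have "\<dots> \<le> t * (1 / 10)"
    using independence t x by (intro mult_left_mono) (auto simp: pos_divide_le_eq)
  finally have 2: "sum w X2 \<le> t / 10" by simp
  \<comment> \<open>Markov's inequality for the number of bad vertices.\<close>
  have "real n * sum w X3 = (\<Sum>G\<in>X3. real n * w G)" by (simp add: sum_distrib_left)
  also have "\<dots> \<le> (\<Sum>G\<in>X3. 4 * (real (card (Bad G)) * w G))"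
  proof (rule sum_mono)
    fix G assume "G \<in> X3"
    then have "real n \<le> 4 * real (card (Bad G))" by (simp add: X3_def)
    then show "real n * w G \<le> 4 * (real (card (Bad G)) * w G)"
      using mult_right_mono[OF _ w0[of G]] by (simp add: mult.assoc[symmetric])
  qed
  also have "\<dots> = 4 * (\<Sum>G\<in>X3. \<Sum>v\<in>V. if v \<in> Bad G then w G else 0)"
    using finV by (simp add: sum_distrib_left[symmetric] sum.If_cases Bad_def Int_def)
  also have "\<dots> = 4 * (\<Sum>v\<in>V. \<Sum>G\<in>X3. if v \<in> Bad G then w G else 0)" by (simp add: sum.swap[of _ V])
  also have "\<dots> \<le> 4 * (\<Sum>v\<in>V. 19 / 100 * t)"
  proof (intro mult_left_mono sum_mono)
    fix v assume v: "v \<in> V"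
    have "(\<Sum>G\<in>X3. if v \<in> Bad G then w G else 0) = sum w {G \<in> X3. v \<in> Bad G}"
      using fin(3) by (simp add: sum.inter_filter)
    also have "\<dots> \<le> sum w {G. G \<subseteq> all_pairs V \<and> card (hop_ball G v r) \<le> (\<Delta> + 1) ^ r \<and>
        \<not> three_colorable_on G (hop_ball G v r)}"
    proof (rule sum_mono2)
      show "finite {G. G \<subseteq> all_pairs V \<and> card (hop_ball G v r) \<le> (\<Delta> + 1) ^ r \<and>
          \<not> three_colorable_on G (hop_ball G v r)}" using finE by (simp add: E_def)
      show "{G \<in> X3. v \<in> Bad G} \<subseteq> {G. G \<subseteq> all_pairs V \<and>
          card (hop_ball G v r) \<le> (\<Delta> + 1) ^ r \<and> \<not> three_colorable_on G (hop_ball G v r)}"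
      proof
        fix G assume "G \<in> {G \<in> X3. v \<in> Bad G}"
        then have G: "G \<subseteq> all_pairs V" "G \<notin> X1" "\<not> three_colorable_on G (hop_ball G v r)"
          by (auto simp: X3_def E_def Bad_def)
        then have "card {e \<in> G. u \<in> e} \<le> \<Delta>" if "u \<in> V" for u
          using that by (auto simp: X1_def E_def not_less)
        then have "card (hop_ball G v r) \<le> (\<Delta> + 1) ^ r"
          by (rule card_hop_ball[OF G(1) finV v])
        then show "G \<in> {G. G \<subseteq> all_pairs V \<and> card (hop_ball G v r) \<le> (\<Delta> + 1) ^ r \<and>
            \<not> three_colorable_on G (hop_ball G v r)}" using G by simp
      qed
    qed (use w0 in auto)
    also have "\<dots> \<le> 19 / 100 * t"
      unfolding w_def t_def E_def
      by (rule weight_bad_ball[OF finV v x]) (use excess_sum_bound[OF x excess] in auto)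
    finally show "(\<Sum>G\<in>X3. if v \<in> Bad G then w G else 0) \<le> 19 / 100 * t" .
  qed auto
  also have "\<dots> = real n * (76 / 100 * t)" by (simp add: cardV)
  finally have 3: "sum w X3 \<le> 76 / 100 * t" using n by simp
  have "\<not> Pow E \<subseteq> X1 \<union> X2 \<union> X3"
  proof
    assume "Pow E \<subseteq> X1 \<union> X2 \<union> X3"
    then have "t \<le> sum w (X1 \<union> X2 \<union> X3)"
      unfolding total[symmetric] using fin w0 by (intro sum_mono2) auto
    also have "\<dots> \<le> sum w X1 + sum w X2 + sum w X3"
      using fin w0 by (simp add: sum_Un sum_nonneg add_increasing2 diff_le_eq)
    finally show False using 1 2 3 t by simp
  qed
  then obtain G where G: "G \<subseteq> E" "G \<notin> X1" "G \<notin> X2" "G \<notin> X3" by blast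
  define W where "W = V - Bad G"
  have sub: "Bad G \<subseteq> V" by (auto simp: Bad_def)
  have "card W = n - card (Bad G)"
    unfolding W_def cardV[symmetric] by (rule card_Diff_subset[OF finite_subset[OF sub finV] sub])
  moreover have "4 * card (Bad G) \<le> n" using G by (auto simp: X3_def)
  ultimately have "3 * n \<le> 4 * card W" by simp
  moreover have "G \<inter> all_pairs S \<noteq> {}" if "S \<subseteq> {..<n}" "card S = s" for S
    using G(1,3) that by (auto simp: X2_def V_def)
  moreover have "three_colorable_on G (hop_ball G v r)" if "v \<in> W" for v
    using that by (auto simp: W_def Bad_def)
  ultimately show ?thesis using that[of G W] G(1) by (auto simp: E_def V_def W_def)
qed

section \<open>The choice of the parameters\<close>

text \<open>Here \<open>9/25\<close> is the ratio of the degree bound \<open>18L/5\<close> and of \<open>10L\<close>.\<close>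

lemma Suc_power_bound: "r > 0 \<Longrightarrow> real (r + 1) * (9 / 25) ^ r \<le> 18 / 25"
proof (induction r rule: nat_induct_non_zero)
  case (Suc r)
  have "real (Suc r + 1) * (9 / 25) ^ Suc r = (real (Suc r + 1) * (9 / 25)) * (9 / 25) ^ r" by simp
  also have "\<dots> \<le> real (r + 1) * (9 / 25) ^ r" by (intro mult_right_mono) auto
  finally show ?case using Suc.IH by linarith
qed simp

text \<open>The conditions on \<open>m\<close> under which the estimates below hold.\<close>

lemma eventually_parameters:
  "\<forall>\<^sub>F m in sequentially. 100 \<le> real m * ln (real m) \<and>
     30 * 10 ^ r * (real m * ln (real m)) ^ (r + 1) * exp (- (3 / 200) * (real m * ln (real m))) \<le> 1 / 10 \<and>
     40 * real m \<le> exp (9 / 8 * ln (real m) - 1 / 10)"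
proof (intro eventually_conj)
  have lim: "filterlim (\<lambda>m. real m * ln (real m)) at_top sequentially" by real_asymp
  then show "\<forall>\<^sub>F m in sequentially. 100 \<le> real m * ln (real m)" by (simp add: filterlim_at_top)
  have "((\<lambda>L::real. 30 * 10 ^ r * L ^ (r + 1) * exp (- (3 / 200) * L)) \<longlongrightarrow> 0) at_top"
    by real_asymp
  then have "\<forall>\<^sub>F L :: real in at_top. 30 * 10 ^ r * L ^ (r + 1) * exp (- (3 / 200) * L) < 1 / 10"
    by (rule order_tendstoD) simp
  from eventually_compose_filterlim[OF this lim]
  show "\<forall>\<^sub>F m in sequentially.
      30 * 10 ^ r * (real m * ln (real m)) ^ (r + 1) * exp (- (3 / 200) * (real m * ln (real m))) \<le> 1 / 10"
    by (rule eventually_mono) simp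
  show "\<forall>\<^sub>F m in sequentially. 40 * real m \<le> exp (9 / 8 * ln (real m) - 1 / 10)" by real_asymp
qed

text \<open>
  The number \<open>s\<close> bounds the sizes of the independent sets. The numbers in the proof are chosen so
  that the expected degree is about \<open>3L\<close>; any multiple of \<open>L\<close> above \<open>8/3\<close> would exclude
  independent sets of \<open>3n/(4m)\<close> vertices when \<open>m\<close> is large.
\<close>

lemma exists_locally_three_colorable_graph:
  assumes r: "r > 0" and L: "L = real m * ln (real m)" and m: "m > 0"
    and L100: "100 \<le> L"
    and deg: "30 * 10 ^ r * L ^ (r + 1) * exp (- (3 / 200) * L) \<le> 1 / 10"
    and ind: "40 * real m \<le> exp (9 / 8 * ln (real m) - 1 / 10)"
  shows "\<exists>n s G W. real n \<le> (30 * L) ^ (r + 1) / 3 ^ r \<and> m * s < card W \<and>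
    G \<subseteq> all_pairs {..<n} \<and> W \<subseteq> {..<n} \<and>
    (\<forall>S\<subseteq>{..<n}. G \<inter> all_pairs S = {} \<longrightarrow> card S \<le> s) \<and>
    (\<forall>v\<in>W. three_colorable_on G (hop_ball G v r))"
proof -
  define Z where "Z = 30 * 10 ^ r * L ^ (r + 1)"
  have Z_eq: "Z = (30 * L) ^ (r + 1) / 3 ^ r"
  proof -
    have "(30 :: real) ^ r = 3 ^ r * 10 ^ r" by (simp add: power_mult_distrib[symmetric])
    then show ?thesis by (simp add: Z_def power_mult_distrib)
  qed
  have L0: "L > 0" using L100 by simp
  have ZL: "30000 * L \<le> Z"
  proof -
    have "(10 :: real) ^ 1 \<le> 10 ^ r" using r by (intro power_increasing) auto
    moreover have "L * 100 \<le> L * L ^ r"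
    proof -
      have "L ^ 1 \<le> L ^ r" using r L100 by (intro power_increasing) auto
      then show ?thesis using L100 L0 by (intro mult_left_mono) auto
    qed
    ultimately have "(30 * 10) * (L * 100) \<le> (30 * 10 ^ r) * (L * L ^ r)"
      using L0 by (intro mult_mono) auto
    then show ?thesis by (simp add: Z_def)
  qed
  define n where "n = nat \<lfloor>Z\<rfloor>"
  have nZ: "real n \<le> Z" "Z < real n + 1" using ZL L0 by (auto simp: n_def)
  have n_big: "Z * (999 / 1000) \<le> real n" "29000 * L \<le> real n" using nZ ZL L100 by auto
  have n0: "n > 0" using n_big(2) L0 by (metis gr0I less_le_not_le mult_pos_pos of_nat_0 zero_less_numeral)
  define p where "p = 3 * L / real n"
  define x where "x = p / (1 - p)"
  have p: "0 < p" "p \<le> 1 / 1000" using n_big(2) L0 n0 by (auto simp: p_def field_simps)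
  have x0: "0 \<le> x" using p by (simp add: x_def)
  have xp: "x / (1 + x) = p" and x1: "1 + x = 1 / (1 - p)" using p by (auto simp: x_def field_simps)
  define \<Delta> where "\<Delta> = nat \<lfloor>7 / 2 * L\<rfloor>"
  have \<Delta>: "7 / 2 * L \<le> real (\<Delta> + 1)" "real (\<Delta> + 1) \<le> 18 / 5 * L"
  proof -
    have "real \<Delta> \<le> 7 / 2 * L \<and> 7 / 2 * L < real \<Delta> + 1" 
      using L0 of_int_floor_le[of "7 / 2 * L"] real_of_int_floor_add_one_gt[of "7 / 2 * L"]
      by (simp add: \<Delta>_def)
    then show "7 / 2 * L \<le> real (\<Delta> + 1)" "real (\<Delta> + 1) \<le> 18 / 5 * L" using L100 by auto
  qed
  define s where "s = nat \<lceil>3 * real n / (4 * real m)\<rceil>"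
  have s_bounds: "3 * real n / (4 * real m) \<le> real s" "real s < 3 * real n / (4 * real m) + 1"
  proof -
    have "3 * real n / (4 * real m) > 0" using n0 m by simp
    then show "3 * real n / (4 * real m) \<le> real s" "real s < 3 * real n / (4 * real m) + 1"
      by (auto simp: s_def) linarith+
  qed
  have s0: "s > 0" using s_bounds(1) n0 m
    by (metis divide_pos_pos mult_pos_pos not_gr_zero not_less of_nat_0 of_nat_0_less_iff zero_less_numeral)

  have degrees: "real n * (1 + 1 / 10 * (x / (1 + x))) ^ n \<le> (1 + 1 / 10) ^ (\<Delta> + 1) / 10"
  proof -
    have "(1 + 1 / 10 * p) ^ n \<le> exp (1 / 10 * p) ^ n"
      using p by (intro power_mono) auto
    also have "\<dots> = exp (real n * (1 / 10 * p))" by (rule exp_of_nat_mult[symmetric])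
    also have "real n * (1 / 10 * p) = 3 / 10 * L" using n0 by (simp add: p_def)
    finally have a: "(1 + 1 / 10 * p) ^ n \<le> exp (3 / 10 * L)" .
    have "(9 / 100 :: real) \<le> ln (1 + 1 / 10)"
      using ln_one_plus_pos_lower_bound[of "1 / 10"] by (simp add: power2_eq_square)
    then have "7 / 2 * L * (9 / 100) \<le> real (\<Delta> + 1) * ln (1 + 1 / 10)"
      using \<Delta>(1) L0 by (intro mult_mono) auto
    then have "exp (63 / 200 * L) \<le> exp (real (\<Delta> + 1) * ln (1 + 1 / 10))" by simp
    also have "\<dots> = (1 + 1 / 10) ^ (\<Delta> + 1)" by (subst exp_of_nat_mult) simp
    finally have b: "exp (63 / 200 * L) \<le> (1 + 1 / 10) ^ (\<Delta> + 1)" .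
    have "real n * (1 + 1 / 10 * p) ^ n \<le> Z * exp (3 / 10 * L)"
      using a nZ(1) p by (intro mult_mono) auto
    also have "\<dots> = (Z * exp (- (3 / 200) * L)) * exp (63 / 200 * L)"
      by (simp add: mult.assoc exp_add[symmetric])
    also have "\<dots> \<le> (1 / 10) * (1 + 1 / 10) ^ (\<Delta> + 1)"
      using deg b unfolding Z_def by (intro mult_mono) auto
    finally show ?thesis by (simp add: xp)
  qed

  have independence: "real (n choose s) \<le> (1 + x) ^ (s choose 2) / 10"
  proof -
    have "real s ^ s \<le> fact s * exp (real s)"
    proof -
      obtain j where j: "s = Suc j" using s0 gr0_implies_Suc by blast
      have "real s ^ s \<le> fact s * exp (real j)" using self_power_le_fact_exp[of j] by (simp add: j)
      also have "\<dots> \<le> fact s * exp (real s)" by (intro mult_left_mono) (auto simp: j)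
      finally show ?thesis .
    qed
    then have fact: "real s ^ s / fact s \<le> exp (real s)" by (simp add: pos_divide_le_eq mult.commute)
    have "real n / (4 * real m / 3) \<le> real s" using s_bounds(1) m by (simp add: field_simps)
    then have "real n \<le> 4 * real m / 3 * real s" using m by (simp add: field_simps)
    then have "real n ^ s \<le> (4 * real m / 3 * real s) ^ s" by (intro power_mono) auto
    then have "real n ^ s / fact s \<le> (4 * real m / 3 * real s) ^ s / fact s"
      by (intro divide_right_mono) auto
    also have "\<dots> = (4 * real m / 3) ^ s * (real s ^ s / fact s)"
      by (simp only: power_mult_distrib times_divide_eq_right)
    also have "\<dots> \<le> (4 * real m / 3) ^ s * exp (real s)" using fact by (intro mult_left_mono) auto
    also have "\<dots> = (4 * real m / 3 * exp 1) ^ s"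
      by (simp only: power_mult_distrib exp_of_nat_mult[symmetric] mult_1_right)
    also have "\<dots> \<le> (4 * real m) ^ s"
      using exp_le mult_left_mono[OF exp_le, of "4 * real m / 3"] by (intro power_mono) auto
    finally have a: "real (n choose s) \<le> (4 * real m) ^ s"
      using binomial_le_power_over_fact[of n s] by linarith
    have lower: "9 / 8 * ln (real m) - 1 / 10 \<le> p * (real s - 1) / 2"
    proof -
      have "9 / 8 * ln (real m) = p * (3 * real n / (4 * real m)) / 2"
        using n0 m by (simp add: p_def L)
      also have "\<dots> \<le> p * real s / 2"
        using p s_bounds(1) by (intro divide_right_mono mult_left_mono) auto
      finally show ?thesis using p by (simp add: algebra_simps)
    qed
    have "10 * (4 * real m) \<le> exp (p * (real s - 1) / 2)"
      using ind lower by (smt (verit) exp_le_cancel_iff)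
    then have "(10 * (4 * real m)) ^ s \<le> exp (p * (real s - 1) / 2) ^ s"
      by (intro power_mono) auto
    also have "\<dots> = exp (p * real (s choose 2))"
    proof -
      obtain j where j: "s = Suc j" using s0 gr0_implies_Suc by blast
      have "2 * (s choose 2) = s * j" by (simp add: choose_two j)
      then have "2 * real (s choose 2) = real s * real j" by (metis of_nat_mult of_nat_numeral)
      then have "real (s choose 2) = real s * (real s - 1) / 2" by (simp add: j)
      then show ?thesis by (simp add: exp_of_nat_mult[symmetric])
    qed
    also have "\<dots> = exp p ^ (s choose 2)" by (simp add: exp_of_nat_mult[symmetric] mult.commute)
    also have "\<dots> \<le> (1 + x) ^ (s choose 2)"
    proof (intro power_mono)
      have "1 - p \<le> exp (- p)" using exp_ge_add_one_self[of "- p"] by simp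
      then show "exp p \<le> 1 + x" using p by (simp add: x1 exp_minus field_simps)
    qed auto
    finally have "10 ^ s * (4 * real m) ^ s \<le> (1 + x) ^ (s choose 2)"
      by (simp only: power_mult_distrib)
    moreover have "10 * (4 * real m) ^ s \<le> 10 ^ s * (4 * real m) ^ s"
      using s0 power_increasing[of 1 s "10 :: real"] by (intro mult_right_mono) auto
    ultimately show ?thesis using a by linarith
  qed

  have excess: "exp 2 * real (r + 1) * real ((\<Delta> + 1) ^ r) * x \<le> 11 / 20"
  proof -
    have "x \<le> p * (1000 / 999)" using p by (simp add: x_def field_simps)
    also have "\<dots> \<le> 3 * L / (Z * (999 / 1000)) * (1000 / 999)"
      unfolding p_def using n_big L0 ZL
      by (intro mult_right_mono divide_left_mono mult_pos_pos) auto
    also have "\<dots> = (1000 / 999)\<^sup>2 * (1 / 10) * (1 / (10 * L) ^ r)"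
      using L0 by (simp add: Z_def power_mult_distrib power2_eq_square field_simps)
    also have "\<dots> \<le> 101 / 1000 * (1 / (10 * L) ^ r)"
      using L0 by (intro mult_right_mono) (auto simp: power2_eq_square)
    finally have xle: "x \<le> 101 / 1000 * (1 / (10 * L) ^ r)" .
    have "real ((\<Delta> + 1) ^ r) \<le> (18 / 5 * L) ^ r"
      unfolding of_nat_power using \<Delta>(2) by (intro power_mono) auto
    then have "real ((\<Delta> + 1) ^ r) * x \<le> (18 / 5 * L) ^ r * (101 / 1000 * (1 / (10 * L) ^ r))"
      using xle x0 L0 by (intro mult_mono) auto
    also have "\<dots> = 101 / 1000 * (9 / 25) ^ r"
    proof -
      have "(18 / 5 * L) ^ r = (9 / 25) ^ r * (10 * L) ^ r"
        by (subst power_mult_distrib[symmetric]) simp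
      then show ?thesis using L0 by simp
    qed
    finally have "real (r + 1) * (real ((\<Delta> + 1) ^ r) * x) \<le> real (r + 1) * (101 / 1000 * (9 / 25) ^ r)"
      by (intro mult_left_mono) auto
    also have "\<dots> \<le> 101 / 1000 * (18 / 25)" using Suc_power_bound[OF r] by simp
    finally have b: "real (r + 1) * (real ((\<Delta> + 1) ^ r) * x) \<le> 101 / 1000 * (18 / 25)" .
    have "exp 2 = (exp 1 :: real)\<^sup>2" by (simp add: exp_double[symmetric])
    also have "\<dots> \<le> (272 / 100)\<^sup>2" using e_less_272 by (intro power_mono) auto
    finally have e: "exp (2 :: real) \<le> (272 / 100)\<^sup>2" .
    have "exp 2 * (real (r + 1) * (real ((\<Delta> + 1) ^ r) * x))
        \<le> (272 / 100)\<^sup>2 * (101 / 1000 * (18 / 25))"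
      by (rule mult_mono[OF e b]) (use x0 in auto)
    then show ?thesis by (simp add: mult.assoc power2_eq_square)
  qed

  obtain G W where GW: "G \<subseteq> all_pairs {..<n}" "W \<subseteq> {..<n}" "3 * n \<le> 4 * card W"
    and nind: "\<And>S. S \<subseteq> {..<n} \<Longrightarrow> card S = s \<Longrightarrow> G \<inter> all_pairs S \<noteq> {}"
    and col: "\<And>v. v \<in> W \<Longrightarrow> three_colorable_on G (hop_ball G v r)"
    using exists_sparse_graph[OF n0 x0 _ degrees independence excess] by auto
  have "card S \<le> s - 1" if S: "S \<subseteq> {..<n}" "G \<inter> all_pairs S = {}" for S
  proof (rule ccontr)
    assume "\<not> card S \<le> s - 1"
    then have "s \<le> card S" by simp
    then obtain T where T: "T \<subseteq> S" "card T = s" using obtain_subset_with_card_n by metis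
    then have "G \<inter> all_pairs T = {}" using S(2) all_pairs_mono[OF T(1)] by blast
    then show False using nind[of T] T S(1) by auto
  qed
  moreover have "m * (s - 1) < card W"
  proof -
    have "real (s - 1) < 3 * real n / (4 * real m)" using s_bounds(2) s0 by simp
    then have "4 * (real m * real (s - 1)) < 3 * real n" using m by (simp add: field_simps)
    then have "real (m * (s - 1)) < real (card W)" using GW(3) by simp
    then show ?thesis by (simp only: of_nat_less_iff)
  qed
  moreover have "real n \<le> (30 * L) ^ (r + 1) / 3 ^ r" using nZ(1) Z_eq by simp
  ultimately show ?thesis using GW(1,2) col by blast
qed

section \<open>Blowing up vertices to cliques\<close>

lemma hop_ball_step:
  assumes "{u, w} \<in> G"
  shows "hop_ball G w i \<subseteq> hop_ball G u (Suc i)"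
proof (induction i)
  case 0
  then show ?case using assms by (auto simp: insert_commute)
next
  case (Suc i)
  then have "x \<in> hop_ball G u (Suc (Suc i))" if "x \<in> hop_ball G w (Suc i)" for x
    using that by auto
  then show ?case by blast
qed

text \<open>The vertices of the blow-up: \<open>w\<close> is replaced by the \<open>k\<close> numbers \<open>a\<close> with \<open>a div k = w\<close>.\<close>

definition copies :: "nat \<Rightarrow> nat set \<Rightarrow> nat set" where
  "copies k W = {a. a div k \<in> W}"

text \<open>
  Each vertex in \<open>W\<close> is replaced by a clique on \<open>k\<close> vertices, and each edge of \<open>G\<close> inside \<open>W\<close> by
  all edges between the two cliques. The vertex set \<open>U\<close> may contain further, isolated vertices,
  which serve to attain every large number of vertices.
\<close>

definition blow_up :: "nat \<Rightarrow> nat set set \<Rightarrow> nat set \<Rightarrow> nat set \<Rightarrow> nat pair_pre_digraph" where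
  "blow_up k G W U = \<lparr>pverts = U, parcs = {(a, b). a \<in> copies k W \<and> b \<in> copies k W \<and> a \<noteq> b \<and>
     (a div k = b div k \<or> {a div k, b div k} \<in> G)}\<rparr>"

lemma copies_card:
  assumes "k > 0" "finite W"
  shows "finite (copies k W)" "card (copies k W) = k * card W"
proof -
  have bij: "bij_betw (\<lambda>(w, i). w * k + i) (W \<times> {..<k}) (copies k W)"
    using assms(1)
    by (intro bij_betw_byWitness[where f' = "\<lambda>a. (a div k, a mod k)"]) (auto simp: copies_def)
  show "finite (copies k W)" using bij_betw_finite[OF bij] assms(2) by simp
  show "card (copies k W) = k * card W"
    using bij_betw_same_card[OF bij] by (simp add: card_cartesian_product mult.commute)
qed

lemma pair_graph_blow_up:
  assumes "finite U" "copies k W \<subseteq> U"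
  shows "pair_graph (blow_up k G W U)"
proof -
  have "parcs (blow_up k G W U) \<subseteq> U \<times> U" using assms(2) by (auto simp: blow_up_def)
  then have "finite (parcs (blow_up k G W U))" using assms(1) finite_subset by blast
  then show ?thesis
    using assms
    by unfold_locales
      (auto simp: blow_up_def symmetric_def sym_def insert_commute)
qed

text \<open>Walks in the blow-up project to walks in \<open>G\<close> that may stay at a vertex.\<close>

lemma blow_up_awalk:
  assumes "pair_graph (blow_up k G W U)"
    and "pre_digraph.awalk (with_proj (blow_up k G W U)) a p b"
  shows "(a = b \<and> p = []) \<or> (a \<in> copies k W \<and> b \<in> copies k W \<and>
           b div k \<in> hop_ball G (a div k) (length p))"
proof -
  interpret pair_graph "blow_up k G W U" by fact
  show ?thesis using assms(2)
  proof (induction p arbitrary: a)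
    case Nil
    then show ?case by (simp add: awalk_Nil_iff)
  next
    case (Cons e p)
    obtain x y where e: "e = (x, y)" by (cases e)
    have xy: "(x, y) \<in> parcs (blow_up k G W U)" "a = x" "awalk y p b"
      using Cons.prems by (auto simp: awalk_Cons_iff e)
    then have c: "x \<in> copies k W" "y \<in> copies k W" "x div k = y div k \<or> {x div k, y div k} \<in> G"
      by (auto simp: blow_up_def)
    have y: "b \<in> copies k W \<and> b div k \<in> hop_ball G (y div k) (length p)"
      using Cons.IH[OF xy(3)] c(2) by auto
    have "hop_ball G (y div k) (length p) \<subseteq> hop_ball G (x div k) (Suc (length p))"
      using c(3) hop_ball_step[of "x div k" "y div k" G "length p"]
        hop_ball_mono[of "length p" "Suc (length p)" G "x div k"] by (auto simp del: hop_ball.simps)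
    then show ?case using y c(1) xy(2) by (auto simp del: hop_ball.simps)
  qed
qed

lemma within_distance_awalk:
  assumes "wf_digraph G" "wf_digraph.\<mu> G (\<lambda>_. 1) a b \<le> ereal (real r)"
  obtains p where "pre_digraph.awalk G a p b" "length p \<le> r"
proof -
  interpret wf_digraph G by fact
  have "\<mu> (\<lambda>_. 1) a b < ereal (real r + 1)"
    using assms(2) by (rule le_less_trans) simp
  then obtain p where p: "awalk a p b" "ereal (awalk_cost (\<lambda>_. 1) p) < ereal (real r + 1)"
    unfolding \<mu>_def INF_less_iff by auto
  moreover have "awalk_cost (\<lambda>_. 1) p = real (length p)"
    by (simp add: awalk_cost_def sum_list_triv)
  ultimately show ?thesis using that by simp
qed

lemma local_chromatic_number_blow_up:
  assumes k: "k > 0" and U: "finite U" "copies k W \<subseteq> U"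
    and col: "\<And>v. v \<in> W \<Longrightarrow> three_colorable_on G (hop_ball G v r)"
  shows "local_chromatic_number r (with_proj (blow_up k G W U)) \<le> 3 * k"
proof -
  define H where "H = blow_up k G W U"
  have pg: "pair_graph H" using pair_graph_blow_up[OF U] by (simp add: H_def)
  interpret pair_graph H by fact
  have "chromatic_number (graph_ball r a (with_proj H)) \<le> 3 * k" for a
  proof -
    define B where "B = {u \<in> verts (with_proj H). \<mu> (\<lambda>_. 1) a u \<le> ereal (real r)}"
    have arcs: "u \<in> B \<and> w \<in> B \<and> (u, w) \<in> parcs H"
      if "u \<rightarrow>\<^bsub>graph_ball r a (with_proj H)\<^esub> w" for u w
      using that by (auto simp: graph_ball_def B_def arcs_ends_def arc_to_ends_def)
    have verts: "verts (graph_ball r a (with_proj H)) = B" by (simp add: graph_ball_def B_def)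
    have reach: "u = a \<or> (a \<in> copies k W \<and> u \<in> copies k W \<and> u div k \<in> hop_ball G (a div k) r)"
      if u: "u \<in> B" for u
    proof -
      obtain p where p: "pre_digraph.awalk (with_proj H) a p u" "length p \<le> r"
        using within_distance_awalk[OF wf_digraph_axioms] u unfolding B_def by blast
      show ?thesis
        using blow_up_awalk[of k G W U a p u] pg p hop_ball_mono[OF p(2), of G "a div k"]
        by (auto simp: H_def)
    qed
    have "colorable (3 * k) (graph_ball r a (with_proj H))"
    proof (cases "a \<in> copies k W")
      case True
      then obtain f where f: "f ` hop_ball G (a div k) r \<subseteq> {..<3 :: nat}"
        "\<And>u w. u \<in> hop_ball G (a div k) r \<Longrightarrow> w \<in> hop_ball G (a div k) r \<Longrightarrow> {u, w} \<in> G \<Longrightarrow> f u \<noteq> f w"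
        using col[of "a div k"] unfolding three_colorable_on_def copies_def by blast
      \<comment> \<open>Each of the three colours is split into \<open>k\<close> colours, one for each vertex of a clique.\<close>
      define g where "g = (\<lambda>u. k * f (u div k) + u mod k)"
      have gdiv: "g u div k = f (u div k)" "g u mod k = u mod k" for u
        using k by (simp_all add: g_def)
      have B: "u div k \<in> hop_ball G (a div k) r" if "u \<in> B" for u using reach[OF that] by auto
      have "g ` B \<subseteq> {..<3 * k}"
      proof
        fix z assume "z \<in> g ` B"
        then obtain u where u: "u \<in> B" "z = g u" by blast
        have "z div k < 3" using gdiv(1) f(1) B[OF u(1)] u(2) by auto
        then show "z \<in> {..<3 * k}" using k by (simp add: div_less_iff_less_mult)
      qed
      moreover have "g u \<noteq> g w" if "u \<rightarrow>\<^bsub>graph_ball r a (with_proj H)\<^esub> w" for u w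
      proof
        assume eq: "g u = g w"
        have uw: "u \<in> B" "w \<in> B" "u \<noteq> w" "u div k = w div k \<or> {u div k, w div k} \<in> G"
          using arcs[OF that] by (auto simp: H_def blow_up_def)
        have "f (u div k) = f (w div k)" "u mod k = w mod k" using eq gdiv by metis+
        moreover from this(1) have "u div k = w div k" using f(2) B uw by blast
        ultimately show False using uw(3) by (metis div_mult_mod_eq)
      qed
      ultimately show ?thesis unfolding colorable_def verts by blast
    next
      case False
      then have "B \<subseteq> {a}" using reach by blast
      have "\<not> u \<rightarrow>\<^bsub>graph_ball r a (with_proj H)\<^esub> w" for u w
      proof
        assume "u \<rightarrow>\<^bsub>graph_ball r a (with_proj H)\<^esub> w"
        from arcs[OF this] have "u = a" "w = a" "(u, w) \<in> parcs H"
          using \<open>B \<subseteq> {a}\<close> by auto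
        then show False using pair_no_loops by fastforce
      qed
      then show ?thesis
        unfolding colorable_def verts using k by (intro exI[of _ "\<lambda>_. 0"]) auto
    qed
    then show ?thesis unfolding chromatic_number_def by (rule Least_le)
  qed
  then show ?thesis
    using U(1) unfolding local_chromatic_number_def H_def[symmetric]
    by (cases "verts (with_proj H) = {}") (auto intro: cSUP_least)
qed

lemma not_colorable_blow_up:
  assumes k: "k > 0" and U: "finite U" "copies k W \<subseteq> U" and W: "finite W"
    and ind: "\<And>S. S \<subseteq> W \<Longrightarrow> G \<inter> all_pairs S = {} \<Longrightarrow> card S \<le> s"
    and large: "m * s < card W"
  shows "\<not> colorable (k * m) (with_proj (blow_up k G W U))"
proof
  assume "colorable (k * m) (with_proj (blow_up k G W U))"
  then obtain f :: "nat \<Rightarrow> nat" where f: "f ` U \<subseteq> {..<k * m}"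
    and proper: "\<And>a b. (a, b) \<in> parcs (blow_up k G W U) \<Longrightarrow> f a \<noteq> f b"
    unfolding colorable_def by (auto simp: blow_up_def)
  define C where "C = copies k W"
  have C: "finite C" "card C = k * card W" using copies_card[OF k W] by (auto simp: C_def)
  \<comment> \<open>A colour class meets each clique at most once and projects to an independent set.\<close>
  have classes: "card {a \<in> C. f a = i} \<le> s" for i
  proof -
    define X where "X = {a \<in> C. f a = i}"
    have apart: "a div k \<noteq> b div k \<and> {a div k, b div k} \<notin> G" if "a \<in> X" "b \<in> X" "a \<noteq> b" for a b
      using proper[of a b] that by (auto simp: X_def C_def blow_up_def)
    then have inj: "inj_on (\<lambda>a. a div k) X" unfolding inj_on_def by blast
    have "G \<inter> all_pairs ((\<lambda>a. a div k) ` X) = {}"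
    proof (rule ccontr)
      assume "G \<inter> all_pairs ((\<lambda>a. a div k) ` X) \<noteq> {}"
      then obtain e where e: "e \<in> G" "e \<subseteq> (\<lambda>a. a div k) ` X" "card e = 2"
        by (auto simp: all_pairs_def)
      then obtain u w where uw: "e = {u, w}" "u \<noteq> w" by (auto simp: card_2_iff)
      then obtain a b where "a \<in> X" "b \<in> X" "u = a div k" "w = b div k" using e(2) by auto
      then show False using apart[of a b] uw e(1) by auto
    qed
    moreover have "(\<lambda>a. a div k) ` X \<subseteq> W" by (auto simp: X_def C_def copies_def)
    ultimately have "card ((\<lambda>a. a div k) ` X) \<le> s" using ind by blast
    then show ?thesis using card_image[OF inj] by (simp add: X_def)
  qed
  have "card C = card (\<Union>i<k * m. {a \<in> C. f a = i})"
    using f U(2) by (intro arg_cong[where f = card]) (auto simp: C_def)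
  also have "\<dots> \<le> (\<Sum>i<k * m. card {a \<in> C. f a = i})" by (rule card_UN_le) simp
  also have "\<dots> \<le> (\<Sum>i<k * m. s)" by (rule sum_mono[OF classes])
  finally have "k * card W \<le> k * (m * s)" using C(2) by (simp add: mult.assoc)
  then show False using large k by simp
qed

section \<open>The extremal function\<close>

lemma colorable_mono: "colorable l G \<Longrightarrow> l \<le> l' \<Longrightarrow> colorable l' G"
  unfolding colorable_def by (meson lessThan_subset_iff order_trans)

text \<open>
  The set of \<open>n\<close> in the definition of the extremal function contains 0 and is bounded by \<open>N\<close>, so
  that \<open>GREATEST\<close> does denote its maximum.
\<close>

lemma f_loc_less:
  assumes "\<And>n. N \<le> n \<Longrightarrow> \<exists>H :: nat pair_pre_digraph. pair_graph H \<and> card (pverts H) = n \<and>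
    local_chromatic_number r (with_proj H) \<le> c \<and> \<not> colorable l (with_proj H)"
  shows "f_loc c l r < N"
proof -
  define P where "P = (\<lambda>n. \<forall>G :: nat pair_pre_digraph. pair_graph G \<longrightarrow> card (pverts G) = n \<longrightarrow>
     local_chromatic_number r (with_proj G) \<le> c \<longrightarrow> colorable l (with_proj G))"
  have bound: "n < N" if "P n" for n
    using assms[of n] that unfolding P_def by (meson not_le)
  have "P 0" unfolding P_def
  proof (intro allI impI)
    fix G :: "nat pair_pre_digraph"
    assume G: "pair_graph G" "card (pverts G) = 0"
    interpret pair_graph G by (rule G(1))
    have "pverts G = {}" using G(2) pair_finite_verts by simp
    then have "parcs G = {}" using in_arcsD1 by fastforce
    then show "colorable l (with_proj G)" using \<open>pverts G = {}\<close> by (simp add: colorable_def)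
  qed
  then have "P (GREATEST n. P n)" by (rule GreatestI_nat[where b = N]) (use bound in fastforce)
  then show ?thesis using bound unfolding f_loc_def P_def by blast
qed

lemma exists_locally_colorable_graphs:
  assumes r: "r > 0"
  shows "\<exists>l0. \<forall>k m. k > 0 \<longrightarrow> m > 0 \<longrightarrow> l0 \<le> k * m \<longrightarrow>
    (\<exists>N. real N \<le> (30 * real (k * m) * ln (real (k * m))) ^ (r + 1) / real (3 * k) ^ r \<and>
      (\<forall>n\<ge>N. \<exists>H :: nat pair_pre_digraph. pair_graph H \<and> card (pverts H) = n \<and>
        local_chromatic_number r (with_proj H) \<le> 3 * k \<and> \<not> colorable (k * m) (with_proj H)))"
proof -
  obtain m0 where m0: "\<And>m. m \<ge> m0 \<Longrightarrow> 100 \<le> real m * ln (real m) \<and>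
     30 * 10 ^ r * (real m * ln (real m)) ^ (r + 1) * exp (- (3 / 200) * (real m * ln (real m))) \<le> 1 / 10 \<and>
     40 * real m \<le> exp (9 / 8 * ln (real m) - 1 / 10)"
    using eventually_parameters[of r] unfolding eventually_sequentially by blast
  define l0 where "l0 = max 1 (nat \<lceil>exp (real m0 * ln (real m0))\<rceil>)"
  show ?thesis
  proof (rule exI[of _ l0], intro allI impI)
    fix k m :: nat
    assume k: "k > 0" and m: "m > 0" and km: "l0 \<le> k * m"
    \<comment> \<open>For \<open>m < m0\<close> the graph for \<open>m0\<close> is used. It is small enough, since \<open>m0 ln m0 \<le> ln (k m)\<close>.\<close>
    define M where "M = max m m0"
    define L where "L = real M * ln (real M)"
    have params: "100 \<le> L" "30 * 10 ^ r * L ^ (r + 1) * exp (- (3 / 200) * L) \<le> 1 / 10"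
      "40 * real M \<le> exp (9 / 8 * ln (real M) - 1 / 10)"
      using m0[of M] by (auto simp: M_def L_def)
    have M: "M > 0" using m by (simp add: M_def)
    obtain n s G W where n: "real n \<le> (30 * L) ^ (r + 1) / 3 ^ r" and s: "M * s < card W"
      and G: "W \<subseteq> {..<n}" and ind: "\<forall>S\<subseteq>{..<n}. G \<inter> all_pairs S = {} \<longrightarrow> card S \<le> s"
      and col: "\<forall>v\<in>W. three_colorable_on G (hop_ball G v r)"
      using exists_locally_three_colorable_graph[OF r L_def M params]
      by (elim exE conjE) (rule that; assumption)
    have W: "finite W" "card W \<le> n"
      using G finite_subset[OF G] card_mono[OF _ G] by auto
    have "m * s \<le> M * s" by (simp add: M_def)
    then have ms: "m * s < card W" using s by linarith
    define N where "N = k * card W"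
    have fin: "finite (copies k W)" and card: "card (copies k W) = N"
      using copies_card[OF k W(1)] by (auto simp: N_def)
    define l where "l = k * m"
    have "1 \<le> l" "m \<le> l" using k m by (auto simp: l_def Suc_le_eq)
    then have lm: "1 \<le> real l" "real m \<le> real l" by simp_all
    have "exp (real m0 * ln (real m0)) \<le> real l0" by (simp add: l0_def) linarith
    also have "\<dots> \<le> real l" using km unfolding l_def of_nat_le_iff .
    finally have l0: "real m0 * ln (real m0) \<le> ln (real l)"
      using lm by (metis exp_le_cancel_iff exp_ln less_le_trans zero_less_one)
    have L_le: "L \<le> real m * ln (real l)"
    proof (cases "m0 \<le> m")
      case True
      then show ?thesis using lm m by (simp add: L_def M_def mult_left_mono)
    next
      case False
      have "1 * ln (real l) \<le> real m * ln (real l)" using m lm by (intro mult_right_mono) auto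
      then show ?thesis using l0 False by (simp add: L_def M_def)
    qed
    have "real N \<le> real k * ((30 * L) ^ (r + 1) / 3 ^ r)"
      unfolding N_def of_nat_mult using n W(2) by (intro mult_left_mono) auto
    also have "\<dots> \<le> real k * ((30 * (real m * ln (real l))) ^ (r + 1) / 3 ^ r)"
      using L_le params(1) by (intro mult_left_mono divide_right_mono power_mono) auto
    also have "\<dots> = (real k * (30 * (real m * ln (real l)))) ^ (r + 1) / (3 * real k) ^ r"
      using k by (simp add: power_mult_distrib)
    also have "\<dots> = (30 * real l * ln (real l)) ^ (r + 1) / real (3 * k) ^ r"
      by (simp add: l_def mult_ac)
    finally have bound: "real N \<le> (30 * real l * ln (real l)) ^ (r + 1) / real (3 * k) ^ r" .
    have "\<exists>H :: nat pair_pre_digraph. pair_graph H \<and> card (pverts H) = n' \<and>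
        local_chromatic_number r (with_proj H) \<le> 3 * k \<and> \<not> colorable (k * m) (with_proj H)"
      if n': "N \<le> n'" for n'
    proof -
      have "infinite (- copies k W)" using fin by simp
      then obtain T where T: "T \<subseteq> - copies k W" "finite T" "card T = n' - N"
        using infinite_arbitrarily_large by metis
      define U where "U = copies k W \<union> T"
      have U: "finite U" "copies k W \<subseteq> U" using fin T(2) by (auto simp: U_def)
      have "copies k W \<inter> T = {}" using T(1) by blast
      then have cU: "card U = n'" using fin T(2,3) card n' by (simp add: U_def card_Un_disjoint)
      have "card (pverts (blow_up k G W U)) = n'" using cU by (simp add: blow_up_def)
      then show ?thesis
        using pair_graph_blow_up[OF U, of G] local_chromatic_number_blow_up[OF k U, of G r] col
          not_colorable_blow_up[OF k U W(1) _ ms, of G] ind order_trans[OF _ G] by blast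
    qed
    then show "\<exists>N. real N \<le> (30 * real (k * m) * ln (real (k * m))) ^ (r + 1) / real (3 * k) ^ r \<and>
      (\<forall>n\<ge>N. \<exists>H :: nat pair_pre_digraph. pair_graph H \<and> card (pverts H) = n \<and>
        local_chromatic_number r (with_proj H) \<le> 3 * k \<and> \<not> colorable (k * m) (with_proj H))"
      using bound unfolding l_def by blast
  qed
qed

theorem theorem6p1:
  fixes r :: nat
  assumes "r > 0"
  shows "\<exists>l0 :: nat.
    (\<forall>c l :: nat. c > 0 \<longrightarrow> 3 dvd c \<longrightarrow> l \<ge> max c l0 \<longrightarrow> (c div 3) dvd l \<longrightarrow>
       real (f_loc c l r) < (30 * real l * ln (real l)) ^ (r + 1) / real c ^ r) \<and>
    (\<exists>C :: real. C > 0 \<and>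
       (\<forall>c l :: nat. c \<ge> 3 \<longrightarrow> l \<ge> max c l0 \<longrightarrow>
          real (f_loc c l r) < (C * real l * ln (real l)) ^ (r + 1) / real c ^ r))"
proof -
  obtain l0 where l0: "\<And>k m. k > 0 \<Longrightarrow> m > 0 \<Longrightarrow> l0 \<le> k * m \<Longrightarrow>
    \<exists>N. real N \<le> (30 * real (k * m) * ln (real (k * m))) ^ (r + 1) / real (3 * k) ^ r \<and>
      (\<forall>n\<ge>N. \<exists>H :: nat pair_pre_digraph. pair_graph H \<and> card (pverts H) = n \<and>
        local_chromatic_number r (with_proj H) \<le> 3 * k \<and> \<not> colorable (k * m) (with_proj H))"
    using exists_locally_colorable_graphs[OF assms] by blast
  have key: "real (f_loc c l r) < (30 * real (k * m) * ln (real (k * m))) ^ (r + 1) / real (3 * k) ^ r"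
    if km: "k > 0" "m > 0" "l0 \<le> k * m" and cl: "3 * k \<le> c" "l \<le> k * m" for c l k m
  proof -
    obtain N where N: "real N \<le> (30 * real (k * m) * ln (real (k * m))) ^ (r + 1) / real (3 * k) ^ r"
      and H: "\<And>n. n \<ge> N \<Longrightarrow> \<exists>H :: nat pair_pre_digraph. pair_graph H \<and> card (pverts H) = n \<and>
        local_chromatic_number r (with_proj H) \<le> 3 * k \<and> \<not> colorable (k * m) (with_proj H)"
      using l0[OF km] by blast
    have "f_loc c l r < N"
      by (rule f_loc_less) (use H cl colorable_mono le_trans in metis)
    then show ?thesis using N by linarith
  qed
  have first: "real (f_loc c l r) < (30 * real l * ln (real l)) ^ (r + 1) / real c ^ r"
    if c: "c > 0" "3 dvd c" and l: "l \<ge> max c l0" and dvd: "(c div 3) dvd l" for c l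
  proof -
    define k where "k = c div 3"
    have k: "c = 3 * k" "k > 0" using c by (auto simp: k_def)
    obtain m where m: "l = k * m" using dvd by (auto simp: k_def)
    have "m > 0" using l c(1) m by (cases m) auto
    then show ?thesis using key[of k m c l] k l m by simp
  qed
  have second: "real (f_loc c l r) < (240 * real l * ln (real l)) ^ (r + 1) / real c ^ r"
    if c: "c \<ge> 3" and l: "l \<ge> max c l0" for c l
  proof -
    define k where "k = c div 3"
    \<comment> \<open>The least multiple of \<open>k\<close> above \<open>l\<close> replaces \<open>l\<close>, and \<open>3 k\<close> replaces \<open>c\<close>.\<close>
    define m where "m = l div k + 1"
    define q where "q = k * m"
    have k: "k > 0" "3 * k \<le> c" "c \<le> 6 * k" using c unfolding k_def by presburger+
    have "l mod k < k" using k(1) by simp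
    moreover have "k * (l div k) + l mod k = l" by (rule mult_div_mod_eq)
    moreover have "q = k * (l div k) + k" by (simp add: q_def m_def)
    moreover have "3 * k \<le> l" using k(2) l by simp
    ultimately have km: "l \<le> q" "q \<le> 2 * l" by linarith+
    have l3: "3 \<le> l" using c l by simp
    have "ln (real q) \<le> ln (2 * real l)" using km l3 by simp
    also have "\<dots> \<le> ln (real l * real l)" using l3 by simp
    also have "\<dots> = 2 * ln (real l)" using l3 by (simp add: ln_mult)
    finally have ln: "ln (real q) \<le> 2 * ln (real l)" .
    have "real q * ln (real q) \<le> (2 * real l) * (2 * ln (real l))"
      using km ln l3 by (intro mult_mono) auto
    then have base: "30 * real q * ln (real q) \<le> 120 * real l * ln (real l)" by simp
    have ckr: "real c ^ r \<le> 2 ^ (r + 1) * real (3 * k) ^ r"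
    proof -
      have "real c ^ r \<le> (2 * real (3 * k)) ^ r" using k(3) by (intro power_mono) auto
      also have "\<dots> = 2 ^ r * real (3 * k) ^ r" by (rule power_mult_distrib)
      also have "\<dots> \<le> 2 ^ (r + 1) * real (3 * k) ^ r" by (intro mult_right_mono) auto
      finally show ?thesis .
    qed
    have "real (f_loc c l r) < (30 * real q * ln (real q)) ^ (r + 1) / real (3 * k) ^ r"
      using key[of k m c l] k km(1) l unfolding q_def m_def by simp
    also have "\<dots> \<le> (120 * real l * ln (real l)) ^ (r + 1) / real (3 * k) ^ r"
      using base km l3 by (intro divide_right_mono power_mono) auto
    also have "\<dots> \<le> (120 * real l * ln (real l)) ^ (r + 1) * (2 ^ (r + 1) / real c ^ r)"
    proof -
      have "1 / real (3 * k) ^ r \<le> 2 ^ (r + 1) / real c ^ r"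
        using ckr k(1) c by (simp add: divide_simps mult.commute)
      then have "(120 * real l * ln (real l)) ^ (r + 1) * (1 / real (3 * k) ^ r)
          \<le> (120 * real l * ln (real l)) ^ (r + 1) * (2 ^ (r + 1) / real c ^ r)"
        using l3 by (intro mult_left_mono) auto
      then show ?thesis by simp
    qed
    also have "\<dots> = (2 * (120 * real l * ln (real l))) ^ (r + 1) / real c ^ r"
      by (subst power_mult_distrib[of 2])
        (simp only: times_divide_eq_right times_divide_eq_left mult.commute)
    also have "2 * (120 * real l * ln (real l)) = 240 * real l * ln (real l)" by simp
    finally show ?thesis .
  qed
  have "\<exists>C :: real. C > 0 \<and> (\<forall>c l :: nat. c \<ge> 3 \<longrightarrow> l \<ge> max c l0 \<longrightarrow>
      real (f_loc c l r) < (C * real l * ln (real l)) ^ (r + 1) / real c ^ r)"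
    using second by (intro exI[of _ 240]) auto
  then show ?thesis using first by blast
qed

end
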